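(* Let $H_1$ be the hypergraph with vertex set $\{1,2,\ldots,67\}$ and edges: $\{1,5,65\}$, $\{1,9,21\}$, $\{1,45,56\}$, $\{2,3,18\}$, $\{2,23,64\}$, $\{2,28,40\}$, $\{3,7,17\}$, $\{3,38,63\}$, $\{4,5,6\}$, $\{4,8,24\}$, $\{4,46,62\}$, $\{5,13,37\}$, $\{5,51,52\}$, $\{6,7,60\}$, $\{6,15,31\}$, $\{6,20,35\}$, $\{7,11,32\}$, $\{7,44,67\}$, $\{8,11,12\}$, $\{8,27,29\}$, $\{9,12,18\}$, $\{9,14,20\}$, $\{10,20,28\}$, $\{10,26,32\}$, $\{10,46,63\}$, $\{11,19,25\}$, $\{12,42,49\}$, $\{13,17,22\}$, $\{13,42,58\}$, $\{14,19,58\}$, $\{14,23,36\}$, $\{15,26,29\}$, $\{15,39,43\}$, $\{16,19,65\}$, $\{16,27,35\}$, $\{16,38,39\}$, $\{17,21,29\}$, $\{19,31,59\}$, $\{21,46,53\}$, $\{22,24,28\}$, $\{22,45,48\}$, $\{23,49,52\}$, $\{24,36,38\}$, $\{25,28,50\}$, $\{25,30,47\}$, $\{27,40,57\}$, $\{30,43,61\}$, $\{31,34,48\}$, $\{32,41,52\}$, $\{33,50,54\}$, $\{33,57,63\}$, $\{33,58,60\}$, $\{34,37,44\}$, $\{34,49,50\}$, $\{35,42,47\}$, $\{39,41,54\}$, $\{40,41,59\}$, $\{40,44,56\}$, $\{42,56,62\}$, $\{43,49,55\}$, $\{45,55,60\}$, $\{46,55,59\}$, $\{47,63,66\}$, $\{48,51,53\}$,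 $\{51,57,61\}$, $\{53,54,67\}$, $\{61,62,64\}$, $\{64,65,66,67\}$. Let $H_2$ be the hypergraph with vertex set $\{1,2,\ldots,21\}$ and edges: $\{1,4,7\}$, $\{1,5,18\}$, $\{1,10,12\}$, $\{2,3,7\}$, $\{2,6,10\}$, $\{2,17,18\}$, $\{3,5,16\}$, $\{3,8,20\}$, $\{3,14,15\}$, $\{4,6,21\}$, $\{4,8,17\}$, $\{4,11,15\}$, $\{5,6,13\}$, $\{7,13,19\}$, $\{8,9,10\}$, $\{9,11,13\}$, $\{9,16,21\}$, $\{10,15,19\}$, $\{11,12,20\}$, $\{12,16,17\}$, $\{13,14,17\}$, $\{18,19,20,21\}$. Then $H_1$ is the Greechie diagram of an orthomodular lattice, $H_2$ is the Greechie diagram of an orthomodular poset, and neither $H_1$ nor $H_2$ (equivalently, neither of the quantum structures they represent) admits a nontrivial group-valued measure.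
   Context: A hypergraph is a pair $(V,E)$ where $V$ is a finite set of vertices and $E$ is a set of nonempty subsets of $V$ (edges) with $\bigcup_{e\in E} e = V$. A cycle of order $k\ge 2$ is a sequence $v_1,e_1,\ldots,v_k,e_k$ of distinct vertices $v_i$ and distinct edges $e_i$ such that $v_i,v_{i+1}\in e_i$ for $1\le i\le k-1$ and $v_1,v_k\in e_k$. A Greechie diagram is a finite hypergraph such that for all distinct edges $e,f$ we have $|e\setminus f|\ge 2$ and $|e\cap f|\le 1$. A Greechie diagram is the diagram of an orthomodular poset (OMP) if and only if it has no cycle of order less than $4$, and of an orthomodular lattice (OML) if and only if it has no cycle of order less than $5$. For a commutative group $G$ (written additively), a group-valued measure on a hypergraph $(V,E)$ is a mapping $\mu:V\to G$ for which there is an element $g\in G$ such that $\sum_{v\in e}\mu(v)=g$ for every edge $e\in E$. It is nontrivial if it does not assign $0$ to every vertex. "Admits no nontrivial group-valued measure" means that none exists for any commutative group $G$. Group-valued measures on a quantum structure represented by a Greechie diagram are identified with the group-valued measures on that diagram. *)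

theory Defs
  imports "HOL-Algebra.Lattice" "HOL-Algebra.FiniteProduct"
begin

section \<open>Hypergraphs and Greechie diagrams\<close>

type_synonym 'a hypergraph = "'a set \<times> 'a set set"

definition hypergraph :: "'a hypergraph \<Rightarrow> bool" where
  "hypergraph H \<longleftrightarrow> finite (fst H) \<and> {} \<notin> snd H \<and> \<Union>(snd H) = fst H"

definition greechie_diagram :: "'a hypergraph \<Rightarrow> bool" where
  "greechie_diagram H \<longleftrightarrow> hypergraph H \<and>
    (\<forall>e\<in>snd H. \<forall>f\<in>snd H. e \<noteq> f \<longrightarrow> card (e - f) \<ge> 2 \<and> card (e \<inter> f) \<le> 1)"


section \<open>Orthomodular posets and lattices\<close>

text \<open>
  In \<open>orthomodular_law\<close> the meet \<open>oc x \<sqinter> y\<close> and the outer join exist by \<open>orthogonal_join\<close>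
  and De Morgan, so the library's choice-based \<open>\<squnion>\<close> and \<open>\<sqinter>\<close> denote the actual bounds.
\<close>

locale orthomodular_poset =
  partial_order L + weak_partial_order_bottom L + weak_partial_order_top L
  for L (structure) +
  fixes oc :: "'a \<Rightarrow> 'a"
  assumes oc_closed: "x \<in> carrier L \<Longrightarrow> oc x \<in> carrier L"
    and oc_oc: "x \<in> carrier L \<Longrightarrow> oc (oc x) = x"
    and oc_antimono: "\<lbrakk>x \<in> carrier L; y \<in> carrier L; x \<sqsubseteq> y\<rbrakk> \<Longrightarrow> oc y \<sqsubseteq> oc x"
    and oc_join: "x \<in> carrier L \<Longrightarrow> is_lub L \<top> {x, oc x}"
    and oc_meet: "x \<in> carrier L \<Longrightarrow> is_glb L \<bottom> {x, oc x}"
    and orthogonal_join: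
      "\<lbrakk>x \<in> carrier L; y \<in> carrier L; x \<sqsubseteq> oc y\<rbrakk> \<Longrightarrow> \<exists>s. is_lub L s {x, y}"
    and orthomodular_law:
      "\<lbrakk>x \<in> carrier L; y \<in> carrier L; x \<sqsubseteq> y\<rbrakk> \<Longrightarrow> y = x \<squnion> (oc x \<sqinter> y)"

locale orthomodular_lattice = orthomodular_poset L oc + lattice L
  for L (structure) and oc

definition atoms :: "('a, 'b) gorder_scheme \<Rightarrow> 'a set" where
  "atoms L = {a \<in> carrier L. a \<noteq> \<bottom>\<^bsub>L\<^esub> \<and>
     (\<forall>x\<in>carrier L. x \<sqsubseteq>\<^bsub>L\<^esub> a \<longrightarrow> x = \<bottom>\<^bsub>L\<^esub> \<or> x = a)}"

definition boolean_subalgebra :: "('a, 'b) gorder_scheme \<Rightarrow> ('a \<Rightarrow> 'a) \<Rightarrow> 'a set \<Rightarrow> bool" where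
  "boolean_subalgebra L oc B \<longleftrightarrow>
    B \<subseteq> carrier L \<and> \<bottom>\<^bsub>L\<^esub> \<in> B \<and> \<top>\<^bsub>L\<^esub> \<in> B \<and> (\<forall>x\<in>B. oc x \<in> B) \<and>
    (\<forall>x\<in>B. \<forall>y\<in>B. (\<exists>s\<in>B. is_lub L s {x, y}) \<and> (\<exists>i\<in>B. is_glb L i {x, y})) \<and>
    (\<forall>x\<in>B. \<forall>y\<in>B. \<forall>z\<in>B.
       x \<sqinter>\<^bsub>L\<^esub> (y \<squnion>\<^bsub>L\<^esub> z) = (x \<sqinter>\<^bsub>L\<^esub> y) \<squnion>\<^bsub>L\<^esub> (x \<sqinter>\<^bsub>L\<^esub> z))"

definition block :: "('a, 'b) gorder_scheme \<Rightarrow> ('a \<Rightarrow> 'a) \<Rightarrow> 'a set \<Rightarrow> bool" where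
  "block L oc B \<longleftrightarrow> boolean_subalgebra L oc B \<and>
    (\<forall>C. boolean_subalgebra L oc C \<and> B \<subseteq> C \<longrightarrow> C = B)"

text \<open>
  Up to renaming of vertices, the vertices of the diagram of a finite structure are its atoms,
  and the edges are the sets of atoms of its blocks.
\<close>

definition diagram_of ::
    "'v hypergraph \<Rightarrow> ('a, 'b) gorder_scheme \<Rightarrow> ('a \<Rightarrow> 'a) \<Rightarrow> bool" where
  "diagram_of H L oc \<longleftrightarrow> finite (carrier L) \<and>
    (\<exists>\<phi>. bij_betw \<phi> (fst H) (atoms L) \<and>
         (`) \<phi> ` snd H = {atoms L \<inter> B |B. block L oc B})"

text \<open>
  Taking the elements of \<open>L\<close> to be sets of vertices is no restriction: a finite orthomodular
  poset is atomistic, so it can be transported along the injection sending an element to the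
  set of vertices representing the atoms below it.
\<close>

definition is_omp_diagram :: "'v hypergraph \<Rightarrow> bool" where
  "is_omp_diagram H \<longleftrightarrow> greechie_diagram H \<and>
    (\<exists>(L :: 'v set gorder) oc. orthomodular_poset L oc \<and> diagram_of H L oc)"

definition is_oml_diagram :: "'v hypergraph \<Rightarrow> bool" where
  "is_oml_diagram H \<longleftrightarrow> greechie_diagram H \<and>
    (\<exists>(L :: 'v set gorder) oc. orthomodular_lattice L oc \<and> diagram_of H L oc)"


section \<open>Group-valued measures\<close>

text \<open>
  Commutative groups are those of \<^theory>\<open>HOL-Algebra.Group\<close>, whose operation is written
  multiplicatively: \<^const>\<open>finprod\<close> is the sum over an edge, and \<open>\<one>\<close> is the zero of the group.
\<close>

definition group_valued_measure ::
    "('g, 'm) monoid_scheme \<Rightarrow> 'v hypergraph \<Rightarrow> ('v \<Rightarrow> 'g) \<Rightarrow> bool" where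
  "group_valued_measure G H \<mu> \<longleftrightarrow> \<mu> \<in> fst H \<rightarrow> carrier G \<and>
    (\<exists>g\<in>carrier G. \<forall>e\<in>snd H. finprod G \<mu> e = g)"

definition nontrivial_measure ::
    "('g, 'm) monoid_scheme \<Rightarrow> 'v hypergraph \<Rightarrow> ('v \<Rightarrow> 'g) \<Rightarrow> bool" where
  "nontrivial_measure G H \<mu> \<longleftrightarrow> group_valued_measure G H \<mu> \<and> (\<exists>v\<in>fst H. \<mu> v \<noteq> \<one>\<^bsub>G\<^esub>)"


section \<open>The two hypergraphs\<close>

definition H1 :: "nat hypergraph" where
  "H1 = ({1..67},
     {{1, 5, 65}, {1, 9, 21}, {1, 45, 56}, {2, 3, 18}, {2, 23, 64}, {2, 28, 40}, {3, 7, 17},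
      {3, 38, 63}, {4, 5, 6}, {4, 8, 24}, {4, 46, 62}, {5, 13, 37}, {5, 51, 52}, {6, 7, 60},
      {6, 15, 31}, {6, 20, 35}, {7, 11, 32}, {7, 44, 67}, {8, 11, 12}, {8, 27, 29},
      {9, 12, 18}, {9, 14, 20}, {10, 20, 28}, {10, 26, 32}, {10, 46, 63}, {11, 19, 25},
      {12, 42, 49}, {13, 17, 22}, {13, 42, 58}, {14, 19, 58}, {14, 23, 36}, {15, 26, 29},
      {15, 39, 43}, {16, 19, 65}, {16, 27, 35}, {16, 38, 39}, {17, 21, 29}, {19, 31, 59},
      {21, 46, 53}, {22, 24, 28}, {22, 45, 48}, {23, 49, 52}, {24, 36, 38}, {25, 28, 50},
      {25, 30, 47}, {27, 40, 57}, {30, 43, 61}, {31, 34, 48}, {32, 41, 52}, {33, 50, 54},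
      {33, 57, 63}, {33, 58, 60}, {34, 37, 44}, {34, 49, 50}, {35, 42, 47}, {39, 41, 54},
      {40, 41, 59}, {40, 44, 56}, {42, 56, 62}, {43, 49, 55}, {45, 55, 60}, {46, 55, 59},
      {47, 63, 66}, {48, 51, 53}, {51, 57, 61}, {53, 54, 67}, {61, 62, 64}, {64, 65, 66, 67}})"

definition H2 :: "nat hypergraph" where
  "H2 = ({1..21},
     {{1, 4, 7}, {1, 5, 18}, {1, 10, 12}, {2, 3, 7}, {2, 6, 10}, {2, 17, 18}, {3, 5, 16},
      {3, 8, 20}, {3, 14, 15}, {4, 6, 21}, {4, 8, 17}, {4, 11, 15}, {5, 6, 13}, {7, 13, 19},
      {8, 9, 10}, {9, 11, 13}, {9, 16, 21}, {10, 15, 19}, {11, 12, 20}, {12, 16, 17},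
      {13, 14, 17}, {18, 19, 20, 21}})"

end

theory Submission
  imports Defs
begin

text \<open>
  The orthomodular structure with a given Greechie diagram is built by Greechie's pasting. Call two
  vertices orthogonal if they are distinct and share an edge, and let \<open>perp A\<close> be the set of
  vertices orthogonal to all of \<open>A\<close>. The elements are the sets \<open>perp (perp A)\<close> for subsets \<open>A\<close> of
  edges, ordered by inclusion and with \<open>perp\<close> as orthocomplement; each element is thereby the set of
  atoms below it. If there are no cycles of order 2 and 3, then pairwise orthogonal vertices lie in a
  common edge (\<open>pairwise_adjacent_in_edge\<close>), and within one edge \<open>e\<close> closure and \<open>perp\<close> behave
  like the Boolean algebra of subsets of \<open>e\<close> (\<open>perp_perp_in_edge\<close>). Suprema of orthogonal elements
  and the orthomodular law therefore reduce to Boolean computations in one edge. In the same way a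
  Boolean subalgebra, being generated by pairwise orthogonal elements, lies in the algebra of one edge
  (\<open>boolean_subalgebra_in_edge_algebra\<close>), so the blocks are exactly these algebras and the diagram
  is the given one. If moreover there are no cycles of order 4, then the common neighbours of two
  nonadjacent vertices are too few to produce new closed sets: every \<open>perp S\<close> is an element and the
  poset is a lattice (\<open>orthomodular_lattice_L\<close>).

  A measure with value \<open>g\<close> on the edges is a solution of a system of linear equations with integer
  coefficients, in the unknowns \<open>g\<close> and the measures of the vertices. For both diagrams the system is
  square with determinant \<open>\<plusminus>1\<close>, so it has only the zero solution in every commutative group.
  A short certificate comes from elimination. A few vertices serve as parameters; the equations of
  most edges determine the measures of the remaining vertices, one at a time, as integer combinations
  of \<open>g\<close> and the parameters. The edges left over give as many relations as there are unknowns, and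
  an explicit integer inverse of this small matrix shows that the unknowns are zero
  (\<open>measure_trivial_if_unimodular\<close>).
\<close>

section \<open>Pasting Boolean algebras along a hypergraph without short cycles\<close>

definition adjacent :: "'v set set \<Rightarrow> 'v \<Rightarrow> 'v \<Rightarrow> bool" where
  "adjacent E a b \<longleftrightarrow> a \<noteq> b \<and> (\<exists>e\<in>E. a \<in> e \<and> b \<in> e)"

lemma adjacent_sym: "adjacent E a b \<Longrightarrow> adjacent E b a"
  by (auto simp: adjacent_def)

lemma Upper_pair:
  assumes "x \<in> carrier L" "y \<in> carrier L"
  shows "Upper L {x, y} = {u \<in> carrier L. x \<sqsubseteq>\<^bsub>L\<^esub> u \<and> y \<sqsubseteq>\<^bsub>L\<^esub> u}"
  using assms by (auto simp: Upper_def)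

lemma Lower_pair:
  assumes "x \<in> carrier L" "y \<in> carrier L"
  shows "Lower L {x, y} = {l \<in> carrier L. l \<sqsubseteq>\<^bsub>L\<^esub> x \<and> l \<sqsubseteq>\<^bsub>L\<^esub> y}"
  using assms by (auto simp: Lower_def)

text \<open>
  The assumption \<open>no_triangle\<close> excludes the cycles of order 3. It also excludes those of order 2,
  that is, two edges with two common vertices \<open>a\<close>, \<open>b\<close>: a third vertex of one of them
  is adjacent to \<open>a\<close> and \<open>b\<close> and hence lies in the other, so the two edges coincide
  (lemma \<open>edge_eqI\<close>).
\<close>

locale triangle_free =
  fixes V :: "'v set" and E :: "'v set set"
  assumes finite_V: "finite V"
    and Union_E: "\<Union>E = V"
    and E_nonempty: "E \<noteq> {}"
    and card_edge: "e \<in> E \<Longrightarrow> 3 \<le> card e"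
    and no_triangle:
      "\<lbrakk>e \<in> E; a \<in> e; b \<in> e; a \<noteq> b; adjacent E c a; adjacent E c b\<rbrakk> \<Longrightarrow> c \<in> e"
begin

lemma edge_subset: "e \<in> E \<Longrightarrow> e \<subseteq> V"
  using Union_E by auto

lemma finite_edge: "e \<in> E \<Longrightarrow> finite e"
  using edge_subset finite_V finite_subset by blast

lemma adjacent_in_V: "adjacent E a b \<Longrightarrow> a \<in> V"
  using Union_E by (auto simp: adjacent_def)

lemma edge_eqI:
  assumes "e \<in> E" "f \<in> E" "a \<in> e" "a \<in> f" "b \<in> e" "b \<in> f" "a \<noteq> b"
  shows "e = f"
proof -
  have "f' \<subseteq> e'" if "e' \<in> E" "f' \<in> E" "a \<in> e'" "a \<in> f'" "b \<in> e'" "b \<in> f'" for e' f'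
  proof
    fix c assume "c \<in> f'"
    show "c \<in> e'"
    proof (cases "c = a \<or> c = b")
      case False
      with \<open>c \<in> f'\<close> that have "adjacent E c a" "adjacent E c b"
        by (auto simp: adjacent_def)
      then show ?thesis
        using no_triangle that \<open>a \<noteq> b\<close> by blast
    qed (use that in auto)
  qed
  then show ?thesis
    using assms by blast
qed

lemma greechie: "greechie_diagram (V, E)"
proof -
  have "card (e \<inter> f) \<le> 1 \<and> 2 \<le> card (e - f)" if "e \<in> E" "f \<in> E" "e \<noteq> f" for e f
  proof -
    have fin: "finite (e \<inter> f)" "finite e"
      using finite_edge that by auto
    have "card (e \<inter> f) \<le> 1"
      using edge_eqI[OF that(1,2)] that(3) fin by (auto simp: card_le_Suc0_iff_eq)
    moreover have "card e = card (e \<inter> f) + card (e - f)"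
      using fin by (simp add: card_Int_Diff)
    ultimately show ?thesis
      using card_edge[OF \<open>e \<in> E\<close>] by linarith
  qed
  moreover have "{} \<notin> E"
    using card_edge by force
  ultimately show ?thesis
    by (simp add: greechie_diagram_def hypergraph_def finite_V Union_E)
qed

text \<open>
  Two elements of a set of pairwise adjacent vertices lie in a common edge, and that edge absorbs all the others
  because there is no triangle. Orthogonal elements can thus be moved into one edge.
\<close>

lemma pairwise_adjacent_in_edge:
  assumes "S \<subseteq> V" and adj: "\<And>a b. \<lbrakk>a \<in> S; b \<in> S; a \<noteq> b\<rbrakk> \<Longrightarrow> adjacent E a b"
  shows "\<exists>e\<in>E. S \<subseteq> e"
proof (cases "\<exists>a\<in>S. \<exists>b\<in>S. a \<noteq> b")
  case True
  then obtain a b where ab: "a \<in> S" "b \<in> S" "a \<noteq> b"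
    by blast
  then obtain e where e: "e \<in> E" "a \<in> e" "b \<in> e"
    using adj adjacent_def by metis
  have "c \<in> e" if "c \<in> S" for c
    using no_triangle[OF e ab(3)] adj[OF that] ab e by metis
  then show ?thesis
    using e by blast
next
  case False
  then have "S = {} \<or> (\<exists>a. S = {a})"
    by blast
  then show ?thesis
    using assms(1) Union_E E_nonempty by auto
qed

definition perp :: "'v set \<Rightarrow> 'v set" where
  "perp A = {v \<in> V. \<forall>a\<in>A. adjacent E v a}"

lemma perp_subset: "perp A \<subseteq> V"
  by (auto simp: perp_def)

lemma perp_antimono: "A \<subseteq> B \<Longrightarrow> perp B \<subseteq> perp A"
  by (auto simp: perp_def)

lemma perp_Un: "perp (A \<union> B) = perp A \<inter> perp B"
  by (auto simp: perp_def)

lemma perp_empty [simp]: "perp {} = V"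
  by (auto simp: perp_def)

lemma Int_perp: "A \<inter> perp A = {}"
  by (auto simp: perp_def adjacent_def)

lemma perp_V [simp]: "perp V = {}"
  using Int_perp perp_subset by blast

lemma subset_perp_perp: "A \<subseteq> V \<Longrightarrow> A \<subseteq> perp (perp A)"
  by (auto simp: perp_def intro: adjacent_sym)

lemma subset_perp_sym: "\<lbrakk>A \<subseteq> perp B; B \<subseteq> V\<rbrakk> \<Longrightarrow> B \<subseteq> perp A"
  using perp_antimono subset_perp_perp by blast

lemma perp_perp_perp: "A \<subseteq> V \<Longrightarrow> perp (perp (perp A)) = perp A"
  by (intro subset_antisym perp_antimono subset_perp_perp perp_subset)

lemma perp_perp_least: "\<lbrakk>A \<subseteq> perp B; B \<subseteq> V\<rbrakk> \<Longrightarrow> perp (perp A) \<subseteq> perp B"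
  using perp_antimono subset_perp_sym by blast

text \<open>
  Two vertices of \<open>A\<close> already force every common neighbour of \<open>A\<close> into
  the edge, so \<open>perp\<close> acts on such subsets as the complement of the Boolean algebra
  \<open>Pow e\<close>.
\<close>

lemma perp_in_edge:
  assumes "e \<in> E" "A \<subseteq> e" "a \<in> A" "b \<in> A" "a \<noteq> b"
  shows "perp A = e - A"
proof
  show "perp A \<subseteq> e - A"
  proof
    fix c assume c: "c \<in> perp A"
    then have "adjacent E c a" "adjacent E c b"
      using assms by (auto simp: perp_def)
    then have "c \<in> e"
      using no_triangle assms by blast
    moreover have "c \<notin> A"
      using c by (auto simp: perp_def adjacent_def)
    ultimately show "c \<in> e - A"
      by blast
  qed
  show "e - A \<subseteq> perp A"
    using assms edge_subset by (auto simp: perp_def adjacent_def)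
qed

text \<open>
  For \<open>A\<close> with at most one element, \<open>perp A\<close> may also contain vertices outside
  \<open>e\<close>, but then \<open>e - A\<close> has two elements, since edges have at least three, and the
  previous lemma applies to it. This identity makes the closures of the subsets of \<open>e\<close> a copy of
  the Boolean algebra \<open>Pow e\<close> inside the orthomodular poset.
\<close>

lemma perp_perp_in_edge:
  assumes "e \<in> E" "A \<subseteq> e"
  shows "perp (perp A) = perp (e - A)"
proof (cases "\<exists>a\<in>A. \<exists>b\<in>A. a \<noteq> b")
  case True
  then show ?thesis
    using perp_in_edge assms by metis
next
  case False
  then have "card A \<le> 1"
    using card_le_Suc0_iff_eq finite_edge assms finite_subset by (metis One_nat_def)
  moreover have "card e \<le> card A + card (e - A)"
    using assms finite_edge
    by (metis card_Diff_subset_Int card_mono inf.absorb2 le_add_diff_inverse le_refl finite_subset)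
  ultimately have "\<not> card (e - A) \<le> Suc 0"
    using card_edge[OF assms(1)] by linarith
  then have "\<exists>a\<in>e - A. \<exists>b\<in>e - A. a \<noteq> b"
    using card_le_Suc0_iff_eq[of "e - A"] finite_edge assms by auto
  then have "perp (e - A) = A"
    using perp_in_edge[OF assms(1), of "e - A"] assms(2) by blast
  then show ?thesis
    using perp_perp_perp[of "e - A"] edge_subset[OF assms(1)] by auto
qed

lemma perp_edge: "e \<in> E \<Longrightarrow> perp e = {}"
  using perp_perp_in_edge[of e "{}"] by simp

lemma perp_perp_singleton:
  assumes "v \<in> V" shows "perp (perp {v}) = {v}"
proof -
  obtain e where e: "e \<in> E" "v \<in> e"
    using assms Union_E by blast
  have "\<not> card (e - {v}) \<le> Suc 0"
    using card_edge[OF e(1)] e finite_edge by simp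
  then obtain a b where "a \<in> e - {v}" "b \<in> e - {v}" "a \<noteq> b"
    using card_le_Suc0_iff_eq[of "e - {v}"] finite_edge e by auto
  then have "perp (e - {v}) = {v}"
    using perp_in_edge[OF e(1), of "e - {v}" a b] e by auto
  then show ?thesis
    using perp_perp_in_edge[of e "{v}"] e by simp
qed

text \<open>
  The pasting of the Boolean algebras \<open>Pow e\<close> along the common vertices, their
  complements and the bounds, with every element represented by the set of atoms below it.
\<close>

definition elements :: "'v set set" where
  "elements = {perp (perp A) |A. \<exists>e\<in>E. A \<subseteq> e}"

lemma perp_perp_element: "\<lbrakk>e \<in> E; A \<subseteq> e\<rbrakk> \<Longrightarrow> perp (perp A) \<in> elements"
  by (auto simp: elements_def)

lemma elementE:
  assumes "X \<in> elements"
  obtains A e where "e \<in> E" "A \<subseteq> e" "X = perp (perp A)" "A \<subseteq> X" "perp X = perp A"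
proof -
  obtain A e where A: "e \<in> E" "A \<subseteq> e" "X = perp (perp A)"
    using assms by (auto simp: elements_def)
  then have "A \<subseteq> V"
    using edge_subset by blast
  then show thesis
    using that[OF A] A subset_perp_perp perp_perp_perp by blast
qed

lemma element_subset: "X \<in> elements \<Longrightarrow> X \<subseteq> V"
  by (auto simp: elements_def perp_def)

lemma element_closed: "X \<in> elements \<Longrightarrow> perp (perp X) = X"
  by (metis elementE)

lemma perp_element_if_in_edge:
  assumes "e \<in> E" "A \<subseteq> e" shows "perp A \<in> elements"
proof -
  have "perp A = perp (perp (e - A))"
    using perp_perp_in_edge[OF assms(1), of "e - A"] assms(2) by (simp add: double_diff)
  then show ?thesis
    using assms(1) by (auto simp: elements_def)
qed

lemma perp_element: "X \<in> elements \<Longrightarrow> perp X \<in> elements"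
  using perp_element_if_in_edge by (metis elementE)

lemma empty_element: "{} \<in> elements"
  using E_nonempty perp_edge perp_element_if_in_edge by force

lemma V_element: "V \<in> elements"
  using perp_element[OF empty_element] by simp

lemma singleton_element: "v \<in> V \<Longrightarrow> {v} \<in> elements"
  using Union_E perp_perp_singleton perp_perp_element by (metis UnionE bot.extremum insert_subset)

lemma finite_elements: "finite elements"
  using element_subset finite_V by (intro finite_subset[of elements "Pow V"]) auto

lemma orthogonal_in_edge:
  assumes "A \<subseteq> e" "e \<in> E" "B \<subseteq> f" "f \<in> E" "A \<subseteq> perp B"
  shows "\<exists>h\<in>E. A \<union> B \<subseteq> h"
proof (rule pairwise_adjacent_in_edge)
  show "A \<union> B \<subseteq> V"
    using assms edge_subset by blast
  fix a b assume "a \<in> A \<union> B" "b \<in> A \<union> B" "a \<noteq> b"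
  moreover have "adjacent E x y" if "x \<in> A" "y \<in> B" for x y
    using that assms(5) by (auto simp: perp_def)
  moreover have "adjacent E x y" if "x \<in> e \<and> y \<in> e \<or> x \<in> f \<and> y \<in> f" "x \<noteq> y" for x y
    using that assms(2,4) by (auto simp: adjacent_def)
  ultimately show "adjacent E a b"
    using \<open>a \<in> A \<union> B\<close> \<open>b \<in> A \<union> B\<close> \<open>a \<noteq> b\<close> assms(1,3) adjacent_sym
    by (metis UnE subsetD)
qed

definition L :: "'v set gorder" where
  "L = \<lparr>carrier = elements, eq = (=), le = (\<subseteq>)\<rparr>"

lemma L_simps [simp]: "carrier L = elements" "le L = (\<subseteq>)" "eq L = (=)"
  by (simp_all add: L_def)

lemma partial_order_L: "partial_order L"
  by unfold_locales simp_all

lemma is_lub_L: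
  assumes "X \<in> elements" "Y \<in> elements"
  shows "is_lub L S {X, Y} \<longleftrightarrow>
    S \<in> elements \<and> X \<subseteq> S \<and> Y \<subseteq> S \<and> (\<forall>Z\<in>elements. X \<subseteq> Z \<and> Y \<subseteq> Z \<longrightarrow> S \<subseteq> Z)"
proof -
  have "Upper L {X, Y} = {Z \<in> elements. X \<subseteq> Z \<and> Y \<subseteq> Z}"
    using Upper_pair[of X L Y] assms by simp
  then show ?thesis
    by (simp add: least_def Ball_def imp_conjL)
qed

lemma is_glb_L:
  assumes "X \<in> elements" "Y \<in> elements"
  shows "is_glb L S {X, Y} \<longleftrightarrow>
    S \<in> elements \<and> S \<subseteq> X \<and> S \<subseteq> Y \<and> (\<forall>Z\<in>elements. Z \<subseteq> X \<and> Z \<subseteq> Y \<longrightarrow> Z \<subseteq> S)"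
proof -
  have "Lower L {X, Y} = {Z \<in> elements. Z \<subseteq> X \<and> Z \<subseteq> Y}"
    using Lower_pair[of X L Y] assms by simp
  then show ?thesis
    by (simp add: greatest_def Ball_def imp_conjL)
qed

lemma join_L: "is_lub L S {X, Y} \<Longrightarrow> X \<squnion>\<^bsub>L\<^esub> Y = S"
  unfolding join_def Lattice.sup_def
  by (rule some_equality) (auto dest: partial_order.least_unique[OF partial_order_L])

lemma meet_L: "is_glb L S {X, Y} \<Longrightarrow> X \<sqinter>\<^bsub>L\<^esub> Y = S"
  unfolding meet_def Lattice.inf_def
  by (rule some_equality) (auto dest: partial_order.greatest_unique[OF partial_order_L])

lemma bottom_L: "\<bottom>\<^bsub>L\<^esub> = {}"
  unfolding bottom_def
  by (rule some_equality) (auto simp: least_def empty_element Upper_def)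

lemma top_L: "\<top>\<^bsub>L\<^esub> = V"
  unfolding top_def
  by (rule some_equality) (use element_subset V_element in \<open>auto simp: greatest_def Lower_def\<close>)

text \<open>
  All singletons are elements, so a greatest lower bound contains every common vertex.
\<close>

lemma is_glb_iff:
  assumes "X \<in> elements" "Y \<in> elements"
  shows "is_glb L S {X, Y} \<longleftrightarrow> S = X \<inter> Y \<and> S \<in> elements"
proof
  assume S: "is_glb L S {X, Y}"
  then have "S \<in> elements" "S \<subseteq> X" "S \<subseteq> Y"
    using assms by (simp_all add: is_glb_L)
  moreover have "v \<in> S" if "v \<in> X" "v \<in> Y" for v
  proof -
    have "{v} \<in> elements"
      using that assms element_subset singleton_element by blast
    then show ?thesis
      using S that assms is_glb_L by (metis empty_subsetI insert_subset)
  qed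
  ultimately show "S = X \<inter> Y \<and> S \<in> elements"
    by blast
qed (use assms in \<open>auto simp: is_glb_L\<close>)

text \<open>
  Dually, \<open>perp {v}\<close> is an upper bound of \<open>X\<close> and \<open>Y\<close> for
  every \<open>v\<close> orthogonal to both, which leaves only one candidate for the least upper
  bound.
\<close>

lemma is_lub_iff:
  assumes "X \<in> elements" "Y \<in> elements"
  shows "is_lub L S {X, Y} \<longleftrightarrow> S = perp (perp X \<inter> perp Y) \<and> S \<in> elements"
proof
  assume S: "is_lub L S {X, Y}"
  then have el: "S \<in> elements" and "X \<subseteq> S" "Y \<subseteq> S"
    using assms by (simp_all add: is_lub_L)
  have "v \<in> perp S" if v: "v \<in> perp X \<inter> perp Y" for v
  proof -
    have "v \<in> V"
      using v perp_subset by blast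
    then have "perp {v} \<in> elements"
      using singleton_element perp_element by blast
    moreover have "X \<subseteq> perp {v}" "Y \<subseteq> perp {v}"
      using v subset_perp_sym[of "{v}"] assms element_subset by simp_all
    ultimately have "S \<subseteq> perp {v}"
      using S assms by (simp add: is_lub_L)
    then show ?thesis
      using subset_perp_sym[of S "{v}"] \<open>v \<in> V\<close> by auto
  qed
  then have "perp X \<inter> perp Y = perp S"
    using perp_antimono \<open>X \<subseteq> S\<close> \<open>Y \<subseteq> S\<close> by blast
  then show "S = perp (perp X \<inter> perp Y) \<and> S \<in> elements"
    using el element_closed by simp
next
  assume S: "S = perp (perp X \<inter> perp Y) \<and> S \<in> elements"
  then have "X \<subseteq> S" "Y \<subseteq> S"
    using assms element_closed perp_antimono[OF Int_lower1] perp_antimono[OF Int_lower2]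
    by metis+
  moreover have "S \<subseteq> Z" if "Z \<in> elements" "X \<subseteq> Z" "Y \<subseteq> Z" for Z
  proof -
    have "perp Z \<subseteq> perp X \<inter> perp Y"
      using that perp_antimono by blast
    then show ?thesis
      using S that element_closed perp_antimono by metis
  qed
  ultimately show "is_lub L S {X, Y}"
    unfolding is_lub_L[OF assms] using conjunct2[OF S] by (intro conjI ballI impI) simp_all
qed


lemma perp_Un_element:
  assumes "A \<subseteq> e" "e \<in> E" "B \<subseteq> f" "f \<in> E" "A \<subseteq> perp B"
  shows "perp A \<inter> perp B \<in> elements"
  using orthogonal_in_edge[OF assms] perp_element_if_in_edge perp_Un by metis

text \<open>
  Elements \<open>X\<close> and \<open>Y\<close> with \<open>X \<subseteq> perp Y\<close> are the closures of
  two disjoint subsets of one edge. This gives their supremum, and with \<open>perp Y\<close> in place of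
  \<open>Y\<close> the orthomodular law.
\<close>

theorem orthomodular_poset_L: "orthomodular_poset L perp"
proof unfold_locales
  fix X Y assume X: "X \<in> carrier L" and Y: "Y \<in> carrier L"
  {
    assume orth: "X \<sqsubseteq>\<^bsub>L\<^esub> perp Y"
    obtain A e where A: "e \<in> E" "A \<subseteq> e" "A \<subseteq> X" "perp X = perp A"
      using X elementE by (metis L_simps(1))
    obtain B f where B: "f \<in> E" "B \<subseteq> f" "perp Y = perp B"
      using Y elementE by (metis L_simps(1))
    have "perp X \<inter> perp Y \<in> elements"
      using perp_Un_element[of A e B f] A B orth by auto
    then have "is_lub L (perp (perp X \<inter> perp Y)) {X, Y}"
      using is_lub_iff X Y perp_element by simp
  }
  note lub = this
  then show "X \<sqsubseteq>\<^bsub>L\<^esub> perp Y \<Longrightarrow> \<exists>s. is_lub L s {X, Y}"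
    by blast
next
  fix X Y assume X: "X \<in> carrier L" and Y: "Y \<in> carrier L" and le: "X \<sqsubseteq>\<^bsub>L\<^esub> Y"
  obtain A e where A: "e \<in> E" "A \<subseteq> e" "A \<subseteq> X" "perp X = perp A" "X = perp (perp A)"
    using X elementE by (metis L_simps(1))
  obtain B f where B: "f \<in> E" "B \<subseteq> f" "perp Y = perp (perp B)"
    using perp_element Y elementE by (metis L_simps(1))
  have "B \<subseteq> V"
    using B edge_subset by blast
  then have Y_eq: "Y = perp B"
    using B(3) Y element_closed perp_perp_perp by (metis L_simps(1))
  then have orth: "A \<subseteq> perp B"
    using A(3) le by simp
  then obtain h where h: "h \<in> E" "A \<union> B \<subseteq> h"
    using orthogonal_in_edge[OF A(2,1) B(2,1)] by blast
  have "perp X \<inter> Y = perp (A \<union> B)"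
    by (simp add: A(4) Y_eq perp_Un)
  then have meet: "perp X \<sqinter>\<^bsub>L\<^esub> Y = perp (A \<union> B)"
    using meet_L is_glb_iff X Y perp_element perp_element_if_in_edge[OF h] by simp
  \<comment> \<open>In the Boolean algebra of \<open>h\<close> the elements \<open>X\<close>, \<open>perp X
    \<inter> Y\<close> and \<open>Y\<close> are the sets \<open>A\<close>, \<open>h - (A
    \<union> B)\<close> and \<open>h - B\<close>.\<close>
  have "perp X \<inter> perp (perp (A \<union> B)) = perp (A \<union> (h - (A \<union> B)))"
    using perp_perp_in_edge[OF h] by (simp add: A(4) perp_Un)
  also have "A \<union> (h - (A \<union> B)) = h - B"
    using h(2) orth Int_perp[of B] by blast
  also have "perp (h - B) = perp Y"
    using perp_perp_in_edge[of h B] h B(3) by simp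
  finally have "is_lub L Y {X, perp (A \<union> B)}"
    using is_lub_iff X Y perp_element_if_in_edge[OF h] element_closed by simp
  then show "Y = X \<squnion>\<^bsub>L\<^esub> (perp X \<sqinter>\<^bsub>L\<^esub> Y)"
    using meet join_L by simp
next
  show "\<exists>X. least L X (carrier L)"
    using empty_element by (auto simp: least_def)
  show "\<exists>X. greatest L X (carrier L)"
    using V_element element_subset by (auto simp: greatest_def)
qed (simp_all add: bottom_L top_L perp_element element_closed perp_antimono is_lub_iff is_glb_iff
    Int_perp Int_perp[unfolded Int_commute[of _ "perp _"]] V_element empty_element)

lemma atoms_L: "atoms L = (\<lambda>v. {v}) ` V"
proof
  show "atoms L \<subseteq> (\<lambda>v. {v}) ` V"
  proof
    fix X assume "X \<in> atoms L"
    then have X: "X \<in> elements" "X \<noteq> {}" "\<And>Y. \<lbrakk>Y \<in> elements; Y \<subseteq> X\<rbrakk> \<Longrightarrow> Y = {} \<or> Y = X"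
      by (simp_all add: atoms_def bottom_L)
    then obtain v where "v \<in> X"
      by blast
    then have "v \<in> V"
      using X(1) element_subset by blast
    then have "X = {v}"
      using X(3)[OF singleton_element] \<open>v \<in> X\<close> by blast
    then show "X \<in> (\<lambda>v. {v}) ` V"
      using \<open>v \<in> V\<close> by blast
  qed
  show "(\<lambda>v. {v}) ` V \<subseteq> atoms L"
    by (auto simp: atoms_def bottom_L singleton_element subset_singleton_iff)
qed

text \<open>
  The block belonging to an edge.
\<close>

definition edge_algebra :: "'v set \<Rightarrow> 'v set set" where
  "edge_algebra e = (\<lambda>A. perp (perp A)) ` Pow e"

lemma edge_algebraI: "A \<subseteq> e \<Longrightarrow> perp (perp A) \<in> edge_algebra e"
  by (auto simp: edge_algebra_def)

lemma edge_algebra_lattice: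
  assumes e: "e \<in> E" "A \<subseteq> e" "B \<subseteq> e"
  shows "is_glb L (perp (perp (A \<inter> B))) {perp (perp A), perp (perp B)}"
    and "is_lub L (perp (perp (A \<union> B))) {perp (perp A), perp (perp B)}"
proof -
  have sub: "A \<subseteq> V" "B \<subseteq> V" "A \<inter> B \<subseteq> e" "A \<union> B \<subseteq> e"
    using e edge_subset by blast+
  have "perp (perp A) \<inter> perp (perp B) = perp ((e - A) \<union> (e - B))"
    using e by (simp add: perp_perp_in_edge perp_Un)
  also have "(e - A) \<union> (e - B) = e - A \<inter> B"
    by blast
  finally have "perp (perp A) \<inter> perp (perp B) = perp (perp (A \<inter> B))"
    using e sub by (simp add: perp_perp_in_edge)
  then show "is_glb L (perp (perp (A \<inter> B))) {perp (perp A), perp (perp B)}"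
    using is_glb_iff perp_perp_element e sub by simp
  have "perp (perp (perp A)) \<inter> perp (perp (perp B)) = perp (A \<union> B)"
    using sub by (simp add: perp_perp_perp perp_Un)
  then show "is_lub L (perp (perp (A \<union> B))) {perp (perp A), perp (perp B)}"
    using is_lub_iff perp_perp_element e sub by simp
qed

lemma boolean_subalgebra_edge_algebra:
  assumes e: "e \<in> E"
  shows "boolean_subalgebra L perp (edge_algebra e)"
  unfolding boolean_subalgebra_def bottom_L top_L
proof (intro conjI ballI)
  let ?cl = "\<lambda>A. perp (perp A)"
  show "edge_algebra e \<subseteq> carrier L"
    using e by (auto simp: edge_algebra_def perp_perp_element)
  show "{} \<in> edge_algebra e"
    using edge_algebraI[of "{}" e] by simp
  show "V \<in> edge_algebra e"
    using edge_algebraI[of e e] perp_edge[OF e] by simp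
  fix X assume "X \<in> edge_algebra e"
  then obtain A where A: "A \<subseteq> e" "X = ?cl A"
    by (auto simp: edge_algebra_def)
  have "perp X = ?cl (e - A)"
    using A perp_perp_in_edge[OF e, of A] by simp
  then show "perp X \<in> edge_algebra e"
    using edge_algebraI[of "e - A" e] by simp
  fix Y assume "Y \<in> edge_algebra e"
  then obtain B where B: "B \<subseteq> e" "Y = ?cl B"
    by (auto simp: edge_algebra_def)
  have sub: "A \<union> B \<subseteq> e" "A \<inter> B \<subseteq> e"
    using A B by auto
  show "\<exists>s\<in>edge_algebra e. is_lub L s {X, Y}"
    using edge_algebra_lattice(2)[OF e A(1) B(1)] A B edge_algebraI[OF sub(1)] by blast
  show "\<exists>i\<in>edge_algebra e. is_glb L i {X, Y}"
    using edge_algebra_lattice(1)[OF e A(1) B(1)] A B edge_algebraI[OF sub(2)] by blast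
  fix Z assume "Z \<in> edge_algebra e"
  then obtain C where C: "C \<subseteq> e" "Z = ?cl C"
    by (auto simp: edge_algebra_def)
  have join: "?cl S \<squnion>\<^bsub>L\<^esub> ?cl T = ?cl (S \<union> T)" and meet: "?cl S \<sqinter>\<^bsub>L\<^esub> ?cl T = ?cl (S \<inter> T)"
    if "S \<subseteq> e" "T \<subseteq> e" for S T
    using edge_algebra_lattice[OF e that] join_L meet_L by simp_all
  have "A \<inter> (B \<union> C) = A \<inter> B \<union> A \<inter> C"
    by blast
  moreover have "B \<union> C \<subseteq> e" "A \<inter> B \<subseteq> e" "A \<inter> C \<subseteq> e"
    using A B C by auto
  ultimately show "X \<sqinter>\<^bsub>L\<^esub> (Y \<squnion>\<^bsub>L\<^esub> Z) = (X \<sqinter>\<^bsub>L\<^esub> Y) \<squnion>\<^bsub>L\<^esub> (X \<sqinter>\<^bsub>L\<^esub> Z)"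
    using A B C by (simp only: join meet)
qed

text \<open>
  A Boolean subalgebra \<open>C\<close> is finite, hence generated by its minimal nonempty
  elements. Disjoint elements of \<open>C\<close> are orthogonal by distributivity. Writing each
  minimal element as the closure of vertices of an edge, all these vertices are therefore pairwise
  adjacent, so that they lie in a single edge \<open>e\<close>. Orthomodularity then shows that
  every element of \<open>C\<close> is the join of the minimal elements below it, hence the
  closure of a subset of \<open>e\<close>.
\<close>

lemma boolean_subalgebra_in_edge_algebra:
  assumes "boolean_subalgebra L perp C"
  shows "\<exists>e\<in>E. C \<subseteq> edge_algebra e"
proof -
  have C_el: "C \<subseteq> elements" and C_empty: "{} \<in> C" and C_V: "V \<in> C"
    and C_perp: "\<And>X. X \<in> C \<Longrightarrow> perp X \<in> C"
    and C_lub: "\<And>X Y. \<lbrakk>X \<in> C; Y \<in> C\<rbrakk> \<Longrightarrow> \<exists>s\<in>C. is_lub L s {X, Y}"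
    and C_glb: "\<And>X Y. \<lbrakk>X \<in> C; Y \<in> C\<rbrakk> \<Longrightarrow> \<exists>i\<in>C. is_glb L i {X, Y}"
    and C_dist: "\<And>X Y Z. \<lbrakk>X \<in> C; Y \<in> C; Z \<in> C\<rbrakk> \<Longrightarrow>
       X \<sqinter>\<^bsub>L\<^esub> (Y \<squnion>\<^bsub>L\<^esub> Z) = (X \<sqinter>\<^bsub>L\<^esub> Y) \<squnion>\<^bsub>L\<^esub> (X \<sqinter>\<^bsub>L\<^esub> Z)"
    using assms unfolding boolean_subalgebra_def bottom_L top_L L_simps by blast+
  have C_Int: "X \<inter> Y \<in> C" "X \<sqinter>\<^bsub>L\<^esub> Y = X \<inter> Y" if XY: "X \<in> C" "Y \<in> C" for X Y
  proof -
    obtain i where i: "i \<in> C" "is_glb L i {X, Y}"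
      using C_glb XY by blast
    then have "i = X \<inter> Y"
      using is_glb_iff[of X Y i] XY C_el by blast
    then show "X \<inter> Y \<in> C" "X \<sqinter>\<^bsub>L\<^esub> Y = X \<inter> Y"
      using i meet_L by auto
  qed
  have C_join: "X \<squnion>\<^bsub>L\<^esub> Y = perp (perp X \<inter> perp Y)" if XY: "X \<in> C" "Y \<in> C" for X Y
  proof -
    obtain s where "is_lub L s {X, Y}"
      using C_lub[OF XY] by blast
    then show ?thesis
      using is_lub_iff[of X Y s] join_L[of s X Y] subsetD[OF C_el] XY by metis
  qed
  have C_sub: "X \<subseteq> V" and C_closed: "perp (perp X) = X" if "X \<in> C" for X
    using element_subset element_closed subsetD[OF C_el that] by simp_all
  have commute: "X \<subseteq> perp Y" if XY: "X \<in> C" "Y \<in> C" "X \<inter> Y = {}" for X Y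
  proof -
    have "Y \<squnion>\<^bsub>L\<^esub> perp Y = V"
      using C_join[OF XY(2) C_perp[OF XY(2)]] Int_perp[of "perp Y"] by (simp add: Int_commute)
    then have "X = X \<sqinter>\<^bsub>L\<^esub> (Y \<squnion>\<^bsub>L\<^esub> perp Y)"
      using C_Int(2)[OF XY(1) C_V] C_sub[OF XY(1)] by auto
    also have "\<dots> = {} \<squnion>\<^bsub>L\<^esub> (X \<inter> perp Y)"
      using C_dist[OF XY(1,2) C_perp[OF XY(2)]] C_Int(2) XY C_perp by simp
    also have "\<dots> = X \<inter> perp Y"
      using C_join[OF C_empty] C_Int(1) XY C_perp C_closed perp_subset
      by (simp add: Int_absorb1)
    finally show ?thesis
      by blast
  qed
  have C_INT: "V \<inter> \<Inter>F \<in> C" if "finite F" "F \<subseteq> C" for F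
    using that
  proof (induction F rule: finite_induct)
    case (insert X F)
    then have "X \<inter> (V \<inter> \<Inter>F) \<in> C"
      using C_Int by simp
    then show ?case
      by (simp add: Int_left_commute)
  qed (simp add: C_V)
  \<comment> \<open>The atoms of \<open>C\<close>; they need not be atoms of \<open>L\<close>.\<close>
  define minimal where "minimal = {X \<in> C. X \<noteq> {} \<and> (\<forall>Y\<in>C. Y \<subseteq> X \<longrightarrow> Y = {} \<or> Y = X)}"
  have fin: "finite C"
    using finite_subset[OF C_el finite_elements] .
  have below: "\<exists>M\<in>minimal. M \<subseteq> X" if X: "X \<in> C" "X \<noteq> {}" for X
  proof -
    obtain M where M: "M \<in> {Y \<in> C. Y \<noteq> {} \<and> Y \<subseteq> X}"
      "\<forall>Y\<in>{Y \<in> C. Y \<noteq> {} \<and> Y \<subseteq> X}. Y \<subseteq> M \<longrightarrow> M = Y"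
      using finite_has_minimal[of "{Y \<in> C. Y \<noteq> {} \<and> Y \<subseteq> X}"] fin X by auto
    then have "M \<in> minimal"
      unfolding minimal_def by blast
    then show ?thesis
      using M by blast
  qed
  have "\<exists>A. (\<exists>e\<in>E. A \<subseteq> e) \<and> M = perp (perp A)" if "M \<in> minimal" for M
  proof -
    have "M \<in> elements"
      using that C_el by (auto simp: minimal_def)
    then show ?thesis
      by (rule elementE) auto
  qed
  \<comment> \<open>\<open>gen M\<close> is a set of vertices in an edge whose join is \<open>M\<close>.\<close>
  then obtain gen
    where gen: "\<And>M. M \<in> minimal \<Longrightarrow> (\<exists>e\<in>E. gen M \<subseteq> e) \<and> M = perp (perp (gen M))"
    by metis
  have gen_sub: "gen M \<subseteq> M" "gen M \<subseteq> V" if "M \<in> minimal" for M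
    using gen[OF that] subset_perp_perp edge_subset by blast+
  obtain e where e: "e \<in> E" "(\<Union>M\<in>minimal. gen M) \<subseteq> e"
  proof -
    have "\<exists>e\<in>E. (\<Union>M\<in>minimal. gen M) \<subseteq> e"
    proof (rule pairwise_adjacent_in_edge)
      show "(\<Union>M\<in>minimal. gen M) \<subseteq> V"
        using gen_sub by blast
      fix a b assume "a \<in> (\<Union>M\<in>minimal. gen M)" "b \<in> (\<Union>M\<in>minimal. gen M)" "a \<noteq> b"
      then obtain M N where MN: "M \<in> minimal" "a \<in> gen M" "N \<in> minimal" "b \<in> gen N"
        by blast
      show "adjacent E a b"
      proof (cases "M = N")
        case True
        then show ?thesis
          using gen[of M] MN \<open>a \<noteq> b\<close> unfolding adjacent_def by blast
      next
        case False
        have "M \<inter> N \<in> C" "M \<in> C" "N \<in> C"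
          using MN C_Int by (auto simp: minimal_def)
        have "M \<inter> N = {} \<or> M \<inter> N = M" "M \<inter> N = {} \<or> M \<inter> N = N"
          using MN \<open>M \<inter> N \<in> C\<close> by (simp_all add: minimal_def)
        then have "M \<inter> N = {}"
          using False by metis
        then have "M \<subseteq> perp N"
          using commute[OF \<open>M \<in> C\<close> \<open>N \<in> C\<close>] by simp
        then have "a \<in> perp N" "b \<in> N"
          using MN gen_sub by blast+
        then show ?thesis
          by (simp add: perp_def)
      qed
    qed
    then show thesis
      using that by blast
  qed
  have "X \<in> edge_algebra e" if X: "X \<in> C" for X
  proof -
    define W where "W = (\<Union>M\<in>{M \<in> minimal. M \<subseteq> X}. gen M)"
    have W: "W \<subseteq> e" "W \<subseteq> X" "W \<subseteq> V"
      using e gen_sub C_sub[OF X] unfolding W_def by blast+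
    have perp_gen: "perp (gen M) = perp M" if "M \<in> minimal" for M
      using gen[OF that] gen_sub(2)[OF that] perp_perp_perp by metis
    have "perp W = V \<inter> \<Inter>(perp ` {M \<in> minimal. M \<subseteq> X})"
    proof -
      have "perp W = V \<inter> (\<Inter>M\<in>{M \<in> minimal. M \<subseteq> X}. perp (gen M))"
        by (auto simp: W_def perp_def)
      then show ?thesis
        using perp_gen by simp
    qed
    also have "\<dots> \<in> C"
      using C_perp fin by (intro C_INT) (auto simp: minimal_def)
    finally have rest: "X \<inter> perp W \<in> C"
      using C_Int(1) X by blast
    \<comment> \<open>A minimal element below this remainder would contribute its vertices to
      \<open>W\<close>.\<close>
    have "X \<inter> perp W = {}"
    proof (rule ccontr)
      assume "X \<inter> perp W \<noteq> {}"
      then obtain M where M: "M \<in> minimal" "M \<subseteq> X \<inter> perp W"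
        using below rest by blast
      then have "gen M \<subseteq> W"
        unfolding W_def by blast
      moreover have "gen M \<subseteq> perp W"
        using M gen_sub by blast
      ultimately have "gen M = {}"
        using Int_perp[of W] by blast
      then have "M = {}"
        using gen[OF M(1)] by simp
      then show False
        using M(1) by (simp add: minimal_def)
    qed
    interpret orthomodular_poset L perp
      by (rule orthomodular_poset_L)
    have cl_W: "perp (perp W) \<in> elements" "perp (perp W) \<subseteq> X"
      using W perp_perp_element e(1) perp_perp_least[of W "perp X"] C_closed[OF X] perp_subset by auto
    have "X = perp (perp W) \<squnion>\<^bsub>L\<^esub> (perp (perp (perp W)) \<sqinter>\<^bsub>L\<^esub> X)"
      using orthomodular_law[of "perp (perp W)" X] cl_W X C_el by auto
    also have "perp (perp (perp W)) \<sqinter>\<^bsub>L\<^esub> X = {}"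
      using is_glb_iff[of "perp W" X] perp_element_if_in_edge[OF e(1) W(1)] subsetD[OF C_el X]
        \<open>X \<inter> perp W = {}\<close> empty_element perp_perp_perp[OF W(3)] meet_L by (simp add: Int_commute)
    also have "perp (perp W) \<squnion>\<^bsub>L\<^esub> {} = perp (perp W)"
      using cl_W(1) W(3) by (intro join_L) (simp add: is_lub_L empty_element del: perp_empty)
    finally show ?thesis
      using edge_algebraI[OF W(1)] by simp
  qed
  then show ?thesis
    using e(1) by blast
qed

lemma singleton_in_edge_algebra:
  assumes "e \<in> E" "v \<in> V"
  shows "{v} \<in> edge_algebra e \<longleftrightarrow> v \<in> e"
proof
  assume "{v} \<in> edge_algebra e"
  then obtain A where A: "A \<subseteq> e" "{v} = perp (perp A)"
    by (auto simp: edge_algebra_def)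
  then have "A \<subseteq> {v}"
    using subset_perp_perp edge_subset[OF assms(1)] by auto
  moreover have "A \<noteq> {}"
    using A(2) by auto
  ultimately show "v \<in> e"
    using A(1) by blast
next
  assume "v \<in> e"
  then show "{v} \<in> edge_algebra e"
    using edge_algebraI[of "{v}" e] perp_perp_singleton[OF assms(2)] by simp
qed

text \<open>
  A maximal Boolean subalgebra is an edge algebra by \<open>boolean_subalgebra_in_edge_algebra\<close>.
  Conversely, the singletons in an edge algebra are the vertices of the edge, so an inclusion of edge algebras
  is an inclusion of edges, and two edges with two common vertices are equal.
\<close>

lemma block_L: "block L perp B \<longleftrightarrow> B \<in> edge_algebra ` E"
proof
  assume B: "block L perp B"
  then obtain e where "e \<in> E" "B \<subseteq> edge_algebra e"
    using boolean_subalgebra_in_edge_algebra[of B] by (auto simp: block_def)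
  then show "B \<in> edge_algebra ` E"
    using B boolean_subalgebra_edge_algebra unfolding block_def by blast
next
  assume "B \<in> edge_algebra ` E"
  then obtain e where e: "e \<in> E" "B = edge_algebra e"
    by blast
  have "C = B" if C: "boolean_subalgebra L perp C" "B \<subseteq> C" for C
  proof -
    obtain f where f: "f \<in> E" "C \<subseteq> edge_algebra f"
      using boolean_subalgebra_in_edge_algebra[OF C(1)] by blast
    have "e \<subseteq> f"
      using singleton_in_edge_algebra edge_subset e f C(2) by blast
    moreover have "\<not> card e \<le> Suc 0"
      using card_edge[OF e(1)] by simp
    then obtain a b where "a \<in> e" "b \<in> e" "a \<noteq> b"
      using card_le_Suc0_iff_eq[OF finite_edge[OF e(1)]] by blast
    ultimately have "e = f"
      using edge_eqI[OF e(1) f(1)] by blast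
    then show ?thesis
      using e f C by blast
  qed
  then show "block L perp B"
    using e boolean_subalgebra_edge_algebra by (auto simp: block_def)
qed

lemma diagram_of_L: "diagram_of (V, E) L perp"
proof -
  have "bij_betw (\<lambda>v. {v}) V (atoms L)"
    by (simp add: atoms_L bij_betw_def)
  moreover have "(\<lambda>v. {v}) ` e = atoms L \<inter> edge_algebra e" if "e \<in> E" for e
    using singleton_in_edge_algebra[OF that] edge_subset[OF that] by (auto simp: atoms_L)
  then have "(`) (\<lambda>v. {v}) ` E = {atoms L \<inter> B |B. block L perp B}"
    by (auto simp: block_L image_iff)
  ultimately show ?thesis
    unfolding diagram_of_def by (auto simp: finite_elements)
qed

theorem omp_diagram: "is_omp_diagram (V, E)"
  unfolding is_omp_diagram_def
  using greechie orthomodular_poset_L diagram_of_L by blast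

end

text \<open>
  Two distinct common neighbours of nonadjacent vertices \<open>u\<close> and \<open>v\<close>
  would give a cycle of order 4 through \<open>u\<close> and \<open>v\<close>.
\<close>

locale quadrangle_free = triangle_free +
  assumes unique_common_neighbour:
    "\<lbrakk>u \<noteq> v; \<not> adjacent E u v; adjacent E w u; adjacent E w v; adjacent E w' u; adjacent E w' v\<rbrakk>
      \<Longrightarrow> w = w'"
begin

text \<open>
  A set of pairwise adjacent vertices lies in an edge, and a set with two nonadjacent vertices has
  at most one common neighbour. In both cases its orthogonal set is an element, so the elements
  are closed under intersection.
\<close>

theorem orthomodular_lattice_L: "orthomodular_lattice L perp"
proof -
  have perp_el: "perp S \<in> elements" if "S \<subseteq> V" for S
  proof (cases "\<exists>u\<in>S. \<exists>v\<in>S. u \<noteq> v \<and> \<not> adjacent E u v")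
    case True
    then obtain u v where "u \<in> S" "v \<in> S" "u \<noteq> v" "\<not> adjacent E u v"
      by blast
    then have "w = w'" if "w \<in> perp S" "w' \<in> perp S" for w w'
      using unique_common_neighbour[of u v w w'] that by (simp add: perp_def)
    then have "perp S = {} \<or> (\<exists>w. perp S = {w})"
      by blast
    then show ?thesis
      using empty_element singleton_element perp_subset[of S] by auto
  next
    case False
    then show ?thesis
      using pairwise_adjacent_in_edge[OF \<open>S \<subseteq> V\<close>] perp_element_if_in_edge by metis
  qed
  have Int_el: "X \<inter> Y \<in> elements" if "X \<in> elements" "Y \<in> elements" for X Y
  proof -
    have "X \<inter> Y = perp (perp X \<union> perp Y)"
      using that by (simp add: perp_Un element_closed)
    then show ?thesis
      using perp_el perp_subset by simp
  qed
  interpret orthomodular_poset L perp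
    by (rule orthomodular_poset_L)
  show ?thesis
  proof unfold_locales
    fix X Y assume "X \<in> carrier L" "Y \<in> carrier L"
    then have el: "X \<in> elements" "Y \<in> elements"
      by simp_all
    show "\<exists>s. is_lub L s {X, Y}"
      using is_lub_iff[OF el] Int_el perp_element el by blast
    show "\<exists>s. is_glb L s {X, Y}"
      using is_glb_iff[OF el] Int_el el by blast
  qed
qed

theorem oml_diagram: "is_oml_diagram (V, E)"
  unfolding is_oml_diagram_def
  using greechie orthomodular_lattice_L diagram_of_L by blast

end

section \<open>Cycle conditions for hypergraphs given by lists\<close>

definition star :: "'v list list \<Rightarrow> 'v \<Rightarrow> 'v list list" where
  "star es v = filter (\<lambda>e. v \<in> set e) es"

definition neighbours :: "'v list list \<Rightarrow> 'v \<Rightarrow> 'v list" where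
  "neighbours es v = concat (map (removeAll v) (star es v))"

lemma adjacent_iff_neighbours: "adjacent (set ` set es) a b \<longleftrightarrow> b \<in> set (neighbours es a)"
  by (auto simp: adjacent_def neighbours_def star_def)

lemma triangle_freeI:
  assumes V: "\<Union> (set ` set es) = V" and "es \<noteq> []"
    and card: "\<forall>e\<in>set es. 3 \<le> card (set e)"
    and triangle: "\<forall>a\<in>V. \<forall>e\<in>set (star es a). \<forall>b\<in>set e. b = a \<or>
      (\<forall>c\<in>set (neighbours es b). c \<in> set (neighbours es a) \<longrightarrow> c \<in> set e)"
  shows "triangle_free V (set ` set es)"
proof
  show "finite V"
    using V by auto
  show "\<Union> (set ` set es) = V" "set ` set es \<noteq> {}"
    using assms by simp_all
  show "3 \<le> card e" if "e \<in> set ` set es" for e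
    using that card by auto
  fix e a b c
  assume *: "e \<in> set ` set es" "a \<in> e" "b \<in> e" "a \<noteq> b"
    "adjacent (set ` set es) c a" "adjacent (set ` set es) c b"
  then obtain f where f: "f \<in> set es" "e = set f"
    by blast
  then have "a \<in> V" "f \<in> set (star es a)" "b \<in> set f"
    using * V by (auto simp: star_def)
  from bspec[OF bspec[OF bspec[OF triangle this(1)] this(2)] this(3)]
  have "\<forall>c\<in>set (neighbours es b). c \<in> set (neighbours es a) \<longrightarrow> c \<in> set f"
    using *(4) by simp
  moreover have "c \<in> set (neighbours es a)" "c \<in> set (neighbours es b)"
    using *(5,6) adjacent_sym adjacent_iff_neighbours by metis+
  ultimately show "c \<in> e"
    using f(2) by simp
qed

lemma distinct_concat_map_unique:
  "\<lbrakk>distinct (concat (map f xs)); x \<in> set xs; y \<in> set xs; z \<in> set (f x); z \<in> set (f y)\<rbrakk> \<Longrightarrow> x = y"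
  by (induction xs) auto

text \<open>
  The list in \<open>paths\<close> contains the end of every path of length two that starts in \<open>v\<close>
  and leads to another vertex, not adjacent to \<open>v\<close>. If it is distinct, two such paths with the same
  end have the same middle vertex.
\<close>

lemma quadrangle_freeI:
  assumes "triangle_free V (set ` set es)"
    and paths: "\<forall>v\<in>V. distinct (concat (map
      (\<lambda>w. filter (\<lambda>u. u \<noteq> v \<and> u \<notin> set (neighbours es v)) (neighbours es w)) (neighbours es v)))"
  shows "quadrangle_free V (set ` set es)"
proof (intro quadrangle_free.intro quadrangle_free_axioms.intro)
  interpret triangle_free V "set ` set es"
    by fact
  fix u v w w'
  assume *: "u \<noteq> v" "\<not> adjacent (set ` set es) u v"
    "adjacent (set ` set es) w u" "adjacent (set ` set es) w v"
    "adjacent (set ` set es) w' u" "adjacent (set ` set es) w' v"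
  then have "v \<in> V"
    using adjacent_in_V adjacent_sym by metis
  let ?far = "\<lambda>w. filter (\<lambda>u. u \<noteq> v \<and> u \<notin> set (neighbours es v)) (neighbours es w)"
  have "\<not> adjacent (set ` set es) v u"
    "adjacent (set ` set es) v w" "adjacent (set ` set es) v w'"
    using * adjacent_sym by metis+
  then have "w \<in> set (neighbours es v)" "w' \<in> set (neighbours es v)"
    "u \<in> set (?far w)" "u \<in> set (?far w')"
    using * by (simp_all add: adjacent_iff_neighbours[symmetric])
  then show "w = w'"
    by (rule distinct_concat_map_unique[OF bspec[OF paths \<open>v \<in> V\<close>]])
qed fact

section \<open>Elimination in systems of edge equations\<close>

context comm_group
begin

definition combination :: "(nat \<Rightarrow> 'a) \<Rightarrow> nat \<Rightarrow> (nat \<Rightarrow> int) \<Rightarrow> 'a" where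
  "combination p k c = (\<Otimes>i\<in>{..<k}. p i [^] c i)"

lemma combination_cong:
  assumes "p \<in> {..<k} \<rightarrow> carrier G" "\<And>i. i < k \<Longrightarrow> c i = d i"
  shows "combination p k c = combination p k d"
  unfolding combination_def using assms by (intro finprod_cong') auto

lemma combination_closed:
  "p \<in> {..<k} \<rightarrow> carrier G \<Longrightarrow> combination p k c \<in> carrier G"
  unfolding combination_def by (rule finprod_closed) auto

lemma combination_add:
  assumes "p \<in> {..<k} \<rightarrow> carrier G"
  shows "combination p k (\<lambda>i. c i + d i) = combination p k c \<otimes> combination p k d"
proof -
  have "combination p k (\<lambda>i. c i + d i) = (\<Otimes>i\<in>{..<k}. p i [^] c i \<otimes> p i [^] d i)"
    unfolding combination_def using assms by (intro finprod_cong') (auto simp: Pi_iff int_pow_mult)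
  also have "\<dots> = combination p k c \<otimes> combination p k d"
    unfolding combination_def using assms by (intro finprod_multf) auto
  finally show ?thesis .
qed

lemma combination_one: "p \<in> {..<k} \<rightarrow> {\<one>} \<Longrightarrow> combination p k c = \<one>"
  unfolding combination_def by (rule finprod_one_eqI) (auto simp: Pi_iff int_pow_one)

lemma combination_zero: "combination p k (\<lambda>i. 0) = \<one>"
  unfolding combination_def by (rule finprod_one_eqI) simp

lemma finprod_int_pow:
  assumes "finite A" "f \<in> A \<rightarrow> carrier G"
  shows "(\<Otimes>i\<in>A. f i [^] (m::int)) = (\<Otimes>i\<in>A. f i) [^] m"
  using assms
proof (induction A rule: finite_induct)
  case (insert a A)
  then have "f a \<in> carrier G" "f \<in> A \<rightarrow> carrier G" "(\<lambda>i. f i [^] m) \<in> A \<rightarrow> carrier G"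
    by auto
  then show ?case
    using insert by (simp add: int_pow_mult_distrib m_comm)
qed simp

lemma combination_eq_one_scale:
  assumes p: "p \<in> {..<k} \<rightarrow> carrier G" and "combination p k c = \<one>"
  shows "combination p k (\<lambda>i. m * c i) = \<one>"
proof -
  have "combination p k (\<lambda>i. m * c i) = (\<Otimes>i\<in>{..<k}. (p i [^] c i) [^] m)"
    unfolding combination_def using p
    by (intro finprod_cong') (auto simp: Pi_iff int_pow_pow mult.commute)
  also have "\<dots> = combination p k c [^] m"
    unfolding combination_def using p by (intro finprod_int_pow) (auto simp: Pi_iff)
  finally show ?thesis
    using assms by simp
qed

lemma combination_unit:
  assumes p: "p \<in> {..<k} \<rightarrow> carrier G" and "j < k"
  shows "combination p k (\<lambda>i. if i = j then 1 else 0) = p j"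
proof -
  have "combination p k (\<lambda>i. if i = j then 1 else 0) = (\<Otimes>i\<in>{..<k}. if j = i then p i else \<one>)"
    unfolding combination_def using p by (intro finprod_cong') (auto simp: Pi_iff int_pow_1)
  also have "\<dots> = p j"
    using p \<open>j < k\<close> by (intro finprod_singleton) auto
  finally show ?thesis .
qed

lemma combination_sum:
  assumes p: "p \<in> {..<k} \<rightarrow> carrier G" and "finite S"
  shows "combination p k (\<lambda>i. \<Sum>x\<in>S. c x i) = (\<Otimes>x\<in>S. combination p k (c x))"
  using \<open>finite S\<close>
proof (induction S rule: finite_induct)
  case (insert x S)
  then show ?case
    using combination_add[OF p] combination_closed[OF p] by (simp add: Pi_def)
qed (simp add: combination_zero)

end

text \<open>
  If \<open>c u\<close> lists the coefficients of the measure of \<open>u\<close> with respect to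
  the common value of the edges (index 0) and further elements, these are the coefficients of the
  sum over \<open>e\<close> minus the common value.
\<close>

definition excess :: "('v \<Rightarrow> int list) \<Rightarrow> 'v list \<Rightarrow> nat \<Rightarrow> int" where
  "excess c e i = (\<Sum>u\<in>set e. c u ! i) - (if i = 0 then 1 else 0)"

text \<open>
  Gaussian elimination over the integers, in a form that can be checked. By induction on
  \<open>stage\<close>, the edge equations of \<open>determined\<close> express the measure of
  every vertex by the value \<open>g\<close> of the edges and the measures of the parameters, with
  coefficient list \<open>c v\<close>; index 0 belongs to \<open>g\<close>. Each residual edge
  then gives a linear relation between these \<open>k\<close> unknowns, and \<open>rows\<close> is
  a left inverse of the matrix of these relations, so the unknowns vanish in every commutative
  group.
\<close>

theorem (in comm_group) measure_trivial_if_unimodular: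
  fixes es residual :: "'v list list" and params :: "'v list"
    and c :: "'v \<Rightarrow> int list" and stage :: "'v \<Rightarrow> nat" and rows :: "int list list"
  assumes hyper: "V = \<Union> (set ` set es)"
    and params: "set params \<subseteq> V" and length: "length params = m" and k: "k = Suc m"
    and c_params: "\<forall>j<m. \<forall>i<k. c (params ! j) ! i = (if i = Suc j then 1 else 0)"
    and determined: "\<forall>v\<in>V. v \<in> set params \<or> (\<exists>e\<in>set (star es v).
      (\<forall>u\<in>set e. u = v \<or> stage u < stage v) \<and> (\<forall>i<k. excess c e i = 0))"
    and residual: "set residual \<subseteq> set es"
    and unimodular: "\<forall>j<k. \<forall>i<k.
      (\<Sum>(a, e)\<leftarrow>zip (rows ! j) residual. a * excess c e i) = (if i = j then 1 else 0)"
  shows "\<not> nontrivial_measure G (V, set ` set es) \<mu>"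
proof
  assume nt: "nontrivial_measure G (V, set ` set es) \<mu>"
  then obtain g where g: "g \<in> carrier G" "\<And>e. e \<in> set es \<Longrightarrow> finprod G \<mu> (set e) = g"
    and \<mu>: "\<mu> \<in> V \<rightarrow> carrier G"
    by (auto simp: nontrivial_measure_def group_valued_measure_def)
  define p where "p = (\<lambda>i. case i of 0 \<Rightarrow> g | Suc j \<Rightarrow> \<mu> (params ! j))"
  define \<Phi> where "\<Phi> = combination p k"
  have p: "p \<in> {..<k} \<rightarrow> carrier G"
    using g \<mu> params by (auto simp: p_def k length[symmetric] Pi_iff subset_iff split: nat.splits)
  have \<Phi>_closed [simp]: "\<Phi> d \<in> carrier G" for d
    unfolding \<Phi>_def by (rule combination_closed[OF p])
  have \<Phi>_unit: "\<Phi> (\<lambda>i. if i = j then 1 else 0) = p j" if "j < k" for j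
    unfolding \<Phi>_def by (rule combination_unit[OF p that])
  have \<Phi>_cong: "\<Phi> d = \<Phi> d'" if "\<And>i. i < k \<Longrightarrow> d i = d' i" for d d'
    unfolding \<Phi>_def using that by (intro combination_cong[OF p])
  have p0: "p 0 = g"
    by (simp add: p_def)
  have sum_edge: "(\<Otimes>u\<in>set e. \<Phi> (\<lambda>i. c u ! i)) = \<Phi> (excess c e) \<otimes> g" for e
  proof -
    have "(\<Otimes>u\<in>set e. \<Phi> (\<lambda>i. c u ! i)) = \<Phi> (\<lambda>i. \<Sum>u\<in>set e. c u ! i)"
      unfolding \<Phi>_def by (simp add: combination_sum[OF p])
    also have "\<dots> = \<Phi> (\<lambda>i. excess c e i + (if i = 0 then 1 else 0))"
      by (simp add: excess_def)
    also have "\<dots> = \<Phi> (excess c e) \<otimes> \<Phi> (\<lambda>i. if i = 0 then 1 else 0)"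
      unfolding \<Phi>_def by (rule combination_add[OF p])
    also have "\<Phi> (\<lambda>i. if i = 0 then 1 else 0) = g"
      using \<Phi>_unit[of 0] p0 by (simp add: k)
    finally show ?thesis .
  qed
  have \<mu>_eq: "\<mu> v = \<Phi> (\<lambda>i. c v ! i)" if "v \<in> V" for v
    using that
  proof (induction v rule: measure_induct_rule[of stage])
    case (less v)
    show ?case
    proof (cases "v \<in> set params")
      case True
      then obtain j where j: "j < m" "v = params ! j"
        using length by (auto simp: in_set_conv_nth)
      have "\<Phi> (\<lambda>i. c v ! i) = \<Phi> (\<lambda>i. if i = Suc j then 1 else 0)"
        using c_params j by (intro \<Phi>_cong) simp
      also have "\<dots> = \<mu> v"
        using \<Phi>_unit[of "Suc j"] j by (simp add: k p_def)
      finally show ?thesis ..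
    next
      case False
      then obtain e where e: "e \<in> set es" "v \<in> set e" "\<forall>u\<in>set e. u = v \<or> stage u < stage v"
        "\<forall>i<k. excess c e i = 0"
        using determined less.prems by (auto simp: star_def)
      have eV: "set e \<subseteq> V"
        using e hyper by auto
      define rest where "rest = (\<Otimes>u\<in>set e - {v}. \<mu> u)"
      have rest: "rest \<in> carrier G"
        unfolding rest_def using \<mu> eV by (intro finprod_closed) auto
      have ins: "set e = insert v (set e - {v})"
        using e(2) by blast
      have "\<mu> v \<otimes> rest = g"
      proof -
        have "finprod G \<mu> (insert v (set e - {v})) = \<mu> v \<otimes> rest"
          unfolding rest_def using \<mu> eV e(2) by (intro finprod_insert) auto
        then show ?thesis
          using g(2)[OF e(1)] ins by simp
      qed
      \<comment> \<open>The expressions of the vertices of \<open>e\<close> add up to \<open>g\<close>, and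
        those of the earlier vertices are known to be correct, so \<open>\<mu> v\<close> and
        its expression are the same difference.\<close>
      moreover have "\<Phi> (\<lambda>i. c v ! i) \<otimes> rest = g"
      proof -
        have "rest = (\<Otimes>u\<in>set e - {v}. \<Phi> (\<lambda>i. c u ! i))"
          unfolding rest_def using less.IH e(3) eV by (intro finprod_cong') auto
        moreover have "(\<Otimes>u\<in>insert v (set e - {v}). \<Phi> (\<lambda>i. c u ! i)) =
            \<Phi> (\<lambda>i. c v ! i) \<otimes> (\<Otimes>u\<in>set e - {v}. \<Phi> (\<lambda>i. c u ! i))"
          by (intro finprod_insert) auto
        moreover have "\<Phi> (excess c e) = \<one>"
        proof -
          have "\<Phi> (excess c e) = \<Phi> (\<lambda>i. 0)"
            using e(4) by (intro \<Phi>_cong) simp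
          then show ?thesis
            by (simp add: \<Phi>_def combination_zero)
        qed
        ultimately show ?thesis
          using sum_edge[of e] ins g(1) by simp
      qed
      moreover have "\<mu> v \<in> carrier G"
        using \<mu> less.prems by auto
      ultimately show ?thesis
        using rest right_cancel[of rest "\<mu> v" "\<Phi> (\<lambda>i. c v ! i)"] by simp
    qed
  qed
  have excess_one: "\<Phi> (excess c e) = \<one>" if "e \<in> set es" for e
  proof -
    have "finprod G \<mu> (set e) = (\<Otimes>u\<in>set e. \<Phi> (\<lambda>i. c u ! i))"
      using \<mu>_eq that hyper by (intro finprod_cong') auto
    then have "\<Phi> (excess c e) \<otimes> g = \<one> \<otimes> g"
      using sum_edge[of e] g that by simp
    then show ?thesis
      using g(1) by simp
  qed
  have list_one: "\<Phi> (\<lambda>i. \<Sum>(a, e)\<leftarrow>ws. a * excess c e i) = \<one>" if "snd ` set ws \<subseteq> set es" for ws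
    using that
  proof (induction ws)
    case Nil
    then show ?case
      by (simp add: \<Phi>_def combination_zero)
  next
    case (Cons w ws)
    obtain a e where w: "w = (a, e)"
      by fastforce
    have "\<Phi> (\<lambda>i. a * excess c e i) = \<one>"
      using combination_eq_one_scale[OF p] excess_one[of e] Cons.prems w by (simp add: \<Phi>_def)
    moreover have "\<Phi> (\<lambda>i. \<Sum>(a, e)\<leftarrow>w # ws. a * excess c e i) =
        \<Phi> (\<lambda>i. a * excess c e i) \<otimes> \<Phi> (\<lambda>i. \<Sum>(a, e)\<leftarrow>ws. a * excess c e i)"
      unfolding \<Phi>_def using combination_add[OF p] by (simp add: w)
    ultimately show ?case
      using Cons by simp
  qed
  have "p j = \<one>" if "j < k" for j
  proof -
    have "snd ` set (zip (rows ! j) residual) \<subseteq> set es"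
      using residual by (auto dest: set_zip_rightD)
    from list_one[OF this] show ?thesis
      using \<Phi>_unit[OF that] \<Phi>_cong[of "\<lambda>i. \<Sum>(a, e)\<leftarrow>zip (rows ! j) residual. a * excess c e i"
          "\<lambda>i. if i = j then 1 else 0"] unimodular that by simp
  qed
  then have "\<Phi> d = \<one>" for d
    unfolding \<Phi>_def by (intro combination_one) auto
  then show False
    using nt \<mu>_eq by (auto simp: nontrivial_measure_def)
qed

section \<open>Rewriting with explicit diagrams\<close>

text \<open>
  The simplifier traverses a literal list anew after each rewriting step, so the diagrams and tables
  are kept opaque. The following lemmas turn them into one short equation per vertex, which the
  later simplifications look up. Conditional equations for \<^const>\<open>star\<close> avoid the exponential
  number of cases that \<open>if\<close> would give without a congruence rule.
\<close>

lemma star_literal: "es = literal \<Longrightarrow> list_all (\<lambda>v. star es v = star literal v) vs"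
  by (simp add: list_all_iff)

lemma star_simps:
  "star [] v = []"
  "v \<notin> set e \<Longrightarrow> star (e # es) v = star es v"
  "v \<in> set e \<Longrightarrow> star (e # es) v = e # star es v"
  by (simp_all add: star_def)

lemma neighbours_star:
  "list_all (\<lambda>v. neighbours es v = concat (map (removeAll v) (star es v))) vs"
  by (simp add: neighbours_def list_all_iff)

definition lookup :: "('v \<times> 'x) list \<Rightarrow> 'v \<Rightarrow> 'x" where
  "lookup t v = the (map_of t v)"

lemma lookup_literal:
  assumes "t = literal" "distinct (map fst literal)"
  shows "list_all (\<lambda>(v, x). lookup t v = x) literal"
  using assms by (auto simp: list_all_iff lookup_def)

lemma all_less_numeral:
  "(\<forall>i<numeral n. P i) \<longleftrightarrow> P (pred_numeral n) \<and> (\<forall>i<pred_numeral n. P i)"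
  by (simp add: numeral_eq_Suc All_less_Suc)

lemma all_less_one: "(\<forall>i<1::nat. P i) \<longleftrightarrow> P 0"
  by auto

lemma nth_Cons_1: "(x # xs) ! 1 = xs ! 0"
  by simp

lemma vertices_eq: "1 \<le> n \<Longrightarrow> m = n + 1 \<Longrightarrow> {1..n} = set (1 # [2..<m])"
  by auto

(* Vertex and index 1 must not turn into Suc 0, as the equations are looked up by numerals. *)
declare One_nat_def [simp del]

section \<open>The diagram with 21 vertices\<close>

definition h2_edges :: "nat list list" where
  "h2_edges =
    [[1, 4, 7], [1, 5, 18], [1, 10, 12], [2, 3, 7], [2, 6, 10], [2, 17, 18], [3, 5, 16], [3, 8,
     20], [3, 14, 15], [4, 6, 21], [4, 8, 17], [4, 11, 15], [5, 6, 13], [7, 13, 19], [8, 9, 10],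
     [9, 11, 13], [9, 16, 21], [10, 15, 19], [11, 12, 20], [12, 16, 17], [13, 14, 17], [18, 19,
     20, 21]]"

definition h2_parameters :: "nat list" where
  "h2_parameters = [3, 14, 17, 20]"

text \<open>
  The entry \<open>(v, s, c)\<close> puts \<open>v\<close> into stage \<open>s\<close> of the elimination: an
  edge equation determines its measure from those of vertices in earlier stages. The coefficients in
  \<open>c\<close> refer to the value of the edges and the four parameters. The parameters have stage 0; they
  were chosen such that the edge equations determine all other vertices one after the other.
\<close>

definition h2_solution :: "(nat \<times> nat \<times> int list) list" where
  "h2_solution =
    [(1, 6, [0, -1, 1, 1, 0]), (2, 8, [1, 0, 0, -1, 0]), (3, 0, [0, 1, 0, 0, 0]), (4, 2, [0, 1,
     0, -1, 1]), (5, 6, [1, -1, -1, 0, 0]), (6, 7, [0, -1, 1, 1, 0]), (7, 7, [0, 0, 0, 1, 0]), (8,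
     1, [1, -1, 0, 0, -1]), (9, 4, [0, 0, 0, 0, 1]), (10, 5, [0, 1, 0, 0, 0]), (11, 3, [0, 0, 1,
     1, -1]), (12, 4, [1, 0, -1, -1, 0]), (13, 1, [1, 0, -1, -1, 0]), (14, 0, [0, 0, 1, 0, 0]),
     (15, 1, [1, -1, -1, 0, 0]), (16, 5, [0, 0, 1, 0, 0]), (17, 0, [0, 0, 0, 1, 0]), (18, 7, [0,
     0, 0, 0, 0]), (19, 6, [0, 0, 1, 0, 0]), (20, 0, [0, 0, 0, 0, 1]), (21, 6, [1, 0, -1, 0, -1])]"

text \<open>
  The edges that the elimination does not use. They yield five relations between five unknowns; their matrix has
  determinant \<open>\<plusminus>1\<close>, and the next definition lists the rows of its inverse.
\<close>

definition h2_residual :: "nat list list" where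
  "h2_residual =
    [[1, 4, 7], [1, 5, 18], [2, 3, 7], [2, 6, 10], [5, 6, 13]]"

definition h2_inverse :: "int list list" where
  "h2_inverse =
    [[0, 0, 2, 1, 1],
     [0, 0, 1, 0, 0],
     [0, 0, 0, 1, 0],
     [0, 1, 2, 0, 0],
     [1, -1, 0, 0, 1]]"

lemmas h2_star =
  star_literal[OF h2_edges_def, of "1 # [2..<22]", simplified,
    simplified star_simps list.set insert_iff empty_iff numeral_eq_iff eq_num_simps
      numeral_eq_one_iff one_eq_numeral_iff de_Morgan_disj not_False_eq_True simp_thms]

lemmas h2_lookup = lookup_literal[OF h2_solution_def, simplified]

lemmas h2_neighbours =
  neighbours_star[of h2_edges "1 # [2..<22]", simplified, simplified h2_star, simplified]

lemma h2_vertices: "{1..21} = set (1 # [2..<22])"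
  by (rule vertices_eq) simp_all

lemma H2_eq: "H2 = ({1..21}, set ` set h2_edges)"
  by (simp add: H2_def h2_edges_def)

lemma h2_Union: "\<Union> (set ` set h2_edges) = {1..21}"
  unfolding h2_vertices by (simp add: h2_edges_def) auto

lemma triangle_free_h2: "triangle_free {1..21} (set ` set h2_edges)"
proof (rule triangle_freeI[OF h2_Union])
  show "h2_edges \<noteq> []" "\<forall>e\<in>set h2_edges. 3 \<le> card (set e)"
    by (simp_all add: h2_edges_def)
  show "\<forall>a\<in>{1..21}. \<forall>e\<in>set (star h2_edges a). \<forall>b\<in>set e. b = a \<or>
      (\<forall>c\<in>set (neighbours h2_edges b). c \<in> set (neighbours h2_edges a) \<longrightarrow> c \<in> set e)"
    unfolding h2_vertices by (simp add: h2_star h2_neighbours)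
qed

lemma no_nontrivial_measure_h2:
  assumes "comm_group G"
  shows "\<not> nontrivial_measure G H2 \<mu>"
  unfolding H2_eq
proof (rule comm_group.measure_trivial_if_unimodular[OF assms h2_Union[symmetric]])
  let ?c = "\<lambda>v. snd (lookup h2_solution v)" and ?stage = "\<lambda>v. fst (lookup h2_solution v)"
  note table = h2_lookup all_less_numeral all_less_one nth_Cons_1
  show "set h2_parameters \<subseteq> {1..21}" "length h2_parameters = 4"
    by (simp_all add: h2_parameters_def)
  show "5 = Suc 4"
    by simp
  show "\<forall>j<4. \<forall>i<5. ?c (h2_parameters ! j) ! i = (if i = Suc j then 1 else 0)"
    by (simp add: h2_parameters_def table)
  show "\<forall>v\<in>{1..21}. v \<in> set h2_parameters \<or> (\<exists>e\<in>set (star h2_edges v).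
      (\<forall>u\<in>set e. u = v \<or> ?stage u < ?stage v) \<and> (\<forall>i<5. excess ?c e i = 0))"
    unfolding h2_vertices by (simp add: h2_star h2_parameters_def excess_def table)
  show "set h2_residual \<subseteq> set h2_edges"
    by (simp add: h2_residual_def h2_edges_def)
  show "\<forall>j<5. \<forall>i<5. (\<Sum>(a, e)\<leftarrow>zip (h2_inverse ! j) h2_residual. a * excess ?c e i) =
      (if i = j then 1 else 0)"
    by (simp add: h2_inverse_def h2_residual_def excess_def table)
qed

section \<open>The diagram with 67 vertices\<close>

definition h1_edges :: "nat list list" where
  "h1_edges =
    [[1, 5, 65], [1, 9, 21], [1, 45, 56], [2, 3, 18], [2, 23, 64], [2, 28, 40], [3, 7, 17], [3,
     38, 63], [4, 5, 6], [4, 8, 24], [4, 46, 62], [5, 13, 37], [5, 51, 52], [6, 7, 60], [6, 15,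
     31], [6, 20, 35], [7, 11, 32], [7, 44, 67], [8, 11, 12], [8, 27, 29], [9, 12, 18], [9, 14,
     20], [10, 20, 28], [10, 26, 32], [10, 46, 63], [11, 19, 25], [12, 42, 49], [13, 17, 22], [13,
     42, 58], [14, 19, 58], [14, 23, 36], [15, 26, 29], [15, 39, 43], [16, 19, 65], [16, 27, 35],
     [16, 38, 39], [17, 21, 29], [19, 31, 59], [21, 46, 53], [22, 24, 28], [22, 45, 48], [23, 49,
     52], [24, 36, 38], [25, 28, 50], [25, 30, 47], [27, 40, 57], [30, 43, 61], [31, 34, 48], [32,
     41, 52], [33, 50, 54], [33, 57, 63], [33, 58, 60], [34, 37, 44], [34, 49, 50], [35, 42, 47],
     [39, 41, 54], [40, 41, 59], [40, 44, 56], [42, 56, 62], [43, 49, 55], [45, 55, 60], [46, 55,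
     59], [47, 63, 66], [48, 51, 53], [51, 57, 61], [53, 54, 67], [61, 62, 64], [64, 65, 66, 67]]"

definition h1_parameters :: "nat list" where
  "h1_parameters = [11, 22, 31, 37, 44, 49, 52, 55, 67]"

text \<open>
  The format is that of \<open>h2_solution\<close>, with nine parameters; ten relations between ten unknowns
  remain.
\<close>

definition h1_solution :: "(nat \<times> nat \<times> int list) list" where
  "h1_solution =
    [(1, 23, [-2, -2, 1, 0, 3, 3, 2, 0, 0, 0]), (2, 22, [2, 2, 0, -1, -3, 0, -5, 1, 0, 1]), (3,
     14, [0, -1, 2, -1, -1, 1, -1, 2, -2, 2]), (4, 12, [1, -1, 2, -2, 1, 0, -1, 2, -3, 0]), (5,
     11, [0, 1, -1, 1, 0, 0, 1, -2, 2, -1]), (6, 5, [0, 0, -1, 1, -1, 0, 0, 0, 1, 1]), (7, 1, [1,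
     0, 0, 0, 0, -1, 0, 0, 0, -1]), (8, 15, [-1, 1, -1, 2, 0, -1, 4, -3, 3, -1]), (9, 24, [0, 3,
     1, 0, -4, 0, -2, 0, 1, 2]), (10, 24, [0, 2, 3, -1, -5, -1, -1, 1, 0, 3]), (11, 0, [0, 1, 0,
     0, 0, 0, 0, 0, 0, 0]), (12, 14, [2, -2, 1, -2, 0, 1, -4, 3, -3, 1]), (13, 12, [1, -1, 1, -1,
     -1, 0, -1, 2, -2, 1]), (14, 20, [0, 2, 0, 1, -3, -1, 0, 0, 1, 1]), (15, 6, [1, 0, 1, -2, 1,
     0, 0, 0, -1, -1]), (16, 23, [2, -2, 0, -3, 3, 2, -3, 2, -3, -1]), (17, 13, [0, 1, -2, 1, 1,
     0, 1, -2, 2, -1]), (18, 23, [-1, -1, -2, 2, 4, -1, 6, -3, 2, -3]), (19, 19, [0, -1, 0, 0, 2,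
     0, 2, -1, 0, -1]), (20, 25, [1, -2, -3, 1, 4, 2, -2, 0, 0, -2]), (21, 22, [1, 0, 1, -3, -1,
     1, -3, 2, -1, 2]), (22, 0, [0, 0, 1, 0, 0, 0, 0, 0, 0, 0]), (23, 1, [1, 0, 0, 0, 0, 0, -1,
     -1, 0, 0]), (24, 16, [1, 0, -1, 0, -1, 1, -3, 1, 0, 1]), (25, 18, [1, 0, 0, 0, -2, 0, -2, 1,
     0, 1]), (26, 24, [0, 1, -2, 0, -1, 1, -2, 0, 2, 2]), (27, 24, [2, 0, 0, -4, 0, 2, -6, 3, -2,
     2]), (28, 17, [0, 0, 0, 0, 1, -1, 3, -1, 0, -1]), (29, 23, [0, -1, 1, 2, 0, -1, 2, 0, -1,
     -1]), (30, 25, [-3, 0, -2, 2, 0, 0, 6, -1, 5, 0]), (31, 0, [0, 0, 0, 1, 0, 0, 0, 0, 0, 0]),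
     (32, 2, [0, -1, 0, 0, 0, 1, 0, 0, 0, 1]), (33, 9, [0, 1, -1, 2, -2, -2, 2, -1, 2, 0]), (34,
     1, [1, 0, 0, 0, -1, -1, 0, 0, 0, 0]), (35, 25, [-3, 2, 0, 7, -3, -4, 9, -5, 5, -1]), (36, 21,
     [0, -2, 0, -1, 3, 1, 1, 1, -1, -1]), (37, 0, [0, 0, 0, 0, 1, 0, 0, 0, 0, 0]), (38, 22, [0, 2,
     1, 1, -2, -2, 2, -2, 1, 0]), (39, 7, [-1, 0, -1, 2, -1, 0, 1, 0, 2, 1]), (40, 21, [-1, -2, 0,
     1, 2, 1, 2, 0, 0, 0]), (41, 3, [1, 1, 0, 0, 0, -1, 0, -1, 0, -1]), (42, 13, [-1, 2, -1, 2, 0,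
     -1, 3, -3, 3, -1]), (43, 1, [1, 0, 0, 0, 0, 0, -1, 0, -1, 0]), (44, 0, [0, 0, 0, 0, 0, 1, 0,
     0, 0, 0]), (45, 3, [1, 0, -1, 1, -1, -1, 0, 0, 0, 0]), (46, 21, [0, -1, 0, 1, 2, 0, 2, -1,
     -1, -1]), (47, 26, [3, 0, 2, -2, 2, 0, -4, 0, -5, -1]), (48, 2, [0, 0, 0, -1, 1, 1, 0, 0, 0,
     0]), (49, 0, [0, 0, 0, 0, 0, 0, 1, 0, 0, 0]), (50, 2, [0, 0, 0, 0, 1, 1, -1, 0, 0, 0]), (51,
     10, [1, -1, 1, -1, 0, 0, -1, 1, -2, 1]), (52, 0, [0, 0, 0, 0, 0, 0, 0, 1, 0, 0]), (53, 9, [0,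
     1, -1, 2, -1, -1, 1, -1, 2, -1]), (54, 8, [1, -1, 1, -2, 1, 1, -1, 1, -2, 0]), (55, 0, [0, 0,
     0, 0, 0, 0, 0, 0, 1, 0]), (56, 22, [2, 2, 0, -1, -2, -2, -2, 0, 0, 0]), (57, 24, [0, 0, 4,
     -2, -1, 1, -1, 1, -3, 2]), (58, 10, [1, -1, 0, -1, 1, 1, -2, 1, -1, 0]), (59, 20, [1, 1, 0,
     -1, -2, 0, -2, 1, 0, 1]), (60, 4, [0, 0, 1, -1, 1, 1, 0, 0, -1, 0]), (61, 24, [3, 0, 2, -2,
     0, 0, -5, 1, -4, 0]), (62, 22, [0, 2, -2, 1, -3, 0, -1, -1, 4, 1]), (63, 23, [1, -1, -3, 0,
     3, 1, -1, 0, 1, -2]), (64, 23, [-2, -2, 0, 1, 3, 0, 6, 0, 0, -1]), (65, 24, [3, 1, 0, -1, -3,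
     -3, -3, 2, -2, 1]), (66, 25, [0, 1, 0, 0, 0, 3, -3, -2, 2, -1]), (67, 0, [0, 0, 0, 0, 0, 0,
     0, 0, 0, 1])]"

definition h1_residual :: "nat list list" where
  "h1_residual =
    [[1, 9, 21], [6, 20, 35], [9, 14, 20], [10, 26, 32], [16, 19, 65], [27, 40, 57], [35, 42,
     47], [42, 56, 62], [47, 63, 66], [51, 57, 61]]"

definition h1_inverse :: "int list list" where
  "h1_inverse =
    [[360312, 149000, -21551, -2881, 343366, -121394, 66770, -23015, -3, -25057],
     [110418, 45661, -6604, -883, 105225, -37201, 20462, -7053, -1, -7679],
     [97201, 40196, -5814, -778, 92629, -32748, 18012, -6208, -1, -6759],
     [104630, 43268, -6258, -837, 99709, -35251, 19389, -6683, -1, -7276],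
     [99595, 41186, -5957, -797, 94911, -33554, 18456, -6361, -1, -6926],
     [143519, 59349, -8584, -1147, 136769, -48354, 26596, -9168, -1, -9981],
     [126364, 52255, -7558, -1010, 120421, -42574, 23417, -8072, -1, -8788],
     [86958, 35960, -5201, -696, 82868, -29297, 16114, -5554, -1, -6047],
     [99457, 41129, -5949, -796, 94779, -33508, 18430, -6352, -1, -6916],
     [115696, 47844, -6920, -925, 110255, -38979, 21440, -7390, -1, -8046]]"

lemmas h1_star =
  star_literal[OF h1_edges_def, of "1 # [2..<68]", simplified,
    simplified star_simps list.set insert_iff empty_iff numeral_eq_iff eq_num_simps
      numeral_eq_one_iff one_eq_numeral_iff de_Morgan_disj not_False_eq_True simp_thms]

lemmas h1_lookup = lookup_literal[OF h1_solution_def, simplified]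

lemmas h1_neighbours =
  neighbours_star[of h1_edges "1 # [2..<68]", simplified, simplified h1_star, simplified]

lemma h1_vertices: "{1..67} = set (1 # [2..<68])"
  by (rule vertices_eq) simp_all

lemma H1_eq: "H1 = ({1..67}, set ` set h1_edges)"
  by (simp add: H1_def h1_edges_def)

lemma h1_Union: "\<Union> (set ` set h1_edges) = {1..67}"
  unfolding h1_vertices by (simp add: h1_edges_def) auto

lemma triangle_free_h1: "triangle_free {1..67} (set ` set h1_edges)"
proof (rule triangle_freeI[OF h1_Union])
  show "h1_edges \<noteq> []" "\<forall>e\<in>set h1_edges. 3 \<le> card (set e)"
    by (simp_all add: h1_edges_def)
  show "\<forall>a\<in>{1..67}. \<forall>e\<in>set (star h1_edges a). \<forall>b\<in>set e. b = a \<or>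
      (\<forall>c\<in>set (neighbours h1_edges b). c \<in> set (neighbours h1_edges a) \<longrightarrow> c \<in> set e)"
    unfolding h1_vertices by (simp add: h1_star h1_neighbours)
qed

lemma quadrangle_free_h1: "quadrangle_free {1..67} (set ` set h1_edges)"
proof (rule quadrangle_freeI[OF triangle_free_h1])
  show "\<forall>v\<in>{1..67}. distinct (concat (map
      (\<lambda>w. filter (\<lambda>u. u \<noteq> v \<and> u \<notin> set (neighbours h1_edges v)) (neighbours h1_edges w))
      (neighbours h1_edges v)))"
    unfolding h1_vertices by (simp add: h1_neighbours)
qed

lemma no_nontrivial_measure_h1:
  assumes "comm_group G"
  shows "\<not> nontrivial_measure G H1 \<mu>"
  unfolding H1_eq
proof (rule comm_group.measure_trivial_if_unimodular[OF assms h1_Union[symmetric]])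
  let ?c = "\<lambda>v. snd (lookup h1_solution v)" and ?stage = "\<lambda>v. fst (lookup h1_solution v)"
  note table = h1_lookup all_less_numeral all_less_one nth_Cons_1
  show "set h1_parameters \<subseteq> {1..67}" "length h1_parameters = 9"
    by (simp_all add: h1_parameters_def)
  show "10 = Suc 9"
    by simp
  show "\<forall>j<9. \<forall>i<10. ?c (h1_parameters ! j) ! i = (if i = Suc j then 1 else 0)"
    by (simp add: h1_parameters_def table)
  show "\<forall>v\<in>{1..67}. v \<in> set h1_parameters \<or> (\<exists>e\<in>set (star h1_edges v).
      (\<forall>u\<in>set e. u = v \<or> ?stage u < ?stage v) \<and> (\<forall>i<10. excess ?c e i = 0))"
    unfolding h1_vertices by (simp add: h1_star h1_parameters_def excess_def table)
  show "set h1_residual \<subseteq> set h1_edges"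
    by (simp add: h1_residual_def h1_edges_def)
  show "\<forall>j<10. \<forall>i<10. (\<Sum>(a, e)\<leftarrow>zip (h1_inverse ! j) h1_residual. a * excess ?c e i) =
      (if i = j then 1 else 0)"
    by (simp add: h1_inverse_def h1_residual_def excess_def table)
qed

section \<open>Conclusion\<close>

theorem theorem6:
  shows "is_oml_diagram H1 \<and>
         is_omp_diagram H2 \<and>
         \<not> (\<exists>(G :: 'g monoid) \<mu>. comm_group G \<and> nontrivial_measure G H1 \<mu>) \<and>
         \<not> (\<exists>(G :: 'g monoid) \<mu>. comm_group G \<and> nontrivial_measure G H2 \<mu>)"
  using quadrangle_free.oml_diagram[OF quadrangle_free_h1]
    triangle_free.omp_diagram[OF triangle_free_h2]
    no_nontrivial_measure_h1 no_nontrivial_measure_h2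
  by (auto simp: H1_eq H2_eq)

end
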